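(* Let $F$ be a germ of biholomorphism of $\mathbb{C}^n$ fixing $0$, with diagonal differential $dF_0=\mathrm{Diag}(\lambda_1,\dots,\lambda_n)$. Let $1\le r\le n$ and suppose that $F$ is $m$-resonant with respect to the first $r$ eigenvalues $\{\lambda_1,\dots,\lambda_r\}$ and of weighted order $k_0$. Then $F^{-1}$ is $m$-resonant with respect to $\{\lambda_1^{-1},\dots,\lambda_r^{-1}\}$ and of weighted order $k_0$. Moreover, if $F$ is attracting-non-degenerate (resp. parabolically attracting) with respect to $\{\lambda_1,\dots,\lambda_r\}$, then $F^{-1}$ is attracting-non-degenerate (resp. parabolically attracting) with respect to $\{\lambda_1^{-1},\dots,\lambda_r^{-1}\}$.
   Context: Conventions: $\mathbb{N}=\{0,1,2,\dots\}$; for a multi-index $Q=(q_1,\dots,q_n)$, $|Q|=\sum_h q_h$ and $z^Q=\prod_h z_h^{q_h}$; $e_j$ is the $j$-th unit vector. The definitions below are given for a germ $F$ with $dF_0=D=\mathrm{Diag}(\lambda_1,\dots,\lambda_n)$, and are applied to $F^{-1}$ with eigenvalues $\lambda_j^{-1}$. Resonances. A resonance is a pair $(j,L)$ with $j\in\{1,\dots,n\}$, $L\in\mathbb{N}^n$, $|L|\ge2$ and $\lambda_j=\lambda^L$. $F$ is $m$-resonant ($m\ge 1$) with respect to the first $r$ eigenvalues if there are $m$ multi-indices $P^1,\dots,P^m\in\mathbb{N}^r\times\{0\}^{n-r}$, linearly independent over $\mathbb{Q}$, such that the resonances $(j,L)$ with $1\le j\le r$ are precisely those of the form $L=e_j+k_1P^1+\dots+k_mP^m$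 with $k_1,\dots,k_m\in\mathbb{N}$ and $k_1+\dots+k_m\ge1$. The $P^t$ are called generators; they are unique up to order. Write $P^t=(p^t_1,\dots,p^t_r,0,\dots,0)$ and, for $K=(k_1,\dots,k_m)\in\mathbb{N}^m$, $K\mathbf{P}=\sum_{t=1}^m k_tP^t$. Normal form and weighted order. By the Poincaré–Dulac theorem, a (possibly formal) change of coordinates tangent to the identity conjugates $F$ to a (possibly formal) Poincaré–Dulac normal form $$\widetilde F(z)=Dz+\sum_{s=1}^r\ \sum_{K\in\mathbb{N}^m,\ K\ne0}a_{K,s}\,z^{K\mathbf{P}}z_s\,e_s+\sum_{s=r+1}^nR_s(z)e_s,\qquad R_s(z)=O(\|z\|^2).$$ The weighted order $k_0$ of $F$ is the minimal $|K|\ge 1$ such that $a_{K,s}\neq0$ for some $1\le s\le r$ ($k_0=+\infty$ if there is none); it does not depend on the normal form. Parabolic shadow. If $k_0<\infty$, the parabolic shadow of $F$ associated with $\widetilde F$ is the map $f(u)=u+H_{k_0+1}(u)$ of $\mathbb{C}^m$, where the $t$-th component of $H_{k_0+1}$, $t=1,\dots,m$, is $$u_t\sum_{K\in\mathbb{N}^m,\,|K|=k_0}\Big(p^t_1\frac{a_{K,1}}{\lambda_1}+\dots+p^t_r\frac{a_{K,r}}{\lambda_r}\Big)u^K.$$ Characteristic directions. A vector $v\in\mathbb{C}^m\setminus\{0\}$ is a non-degenerate characteristic direction of $f$ if $H_{k_0+1}(v)=\tau v$ with $\tau\neq0$. Then $[v]\in\mathbb{CP}^{m-1}$ is a fixed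 point of the rational self-map $\widetilde H_{k_0+1}$ of $\mathbb{CP}^{m-1}$ induced by $H_{k_0+1}$. The directors of $[v]$ are the eigenvalues of $\frac1{k_0}\big(d(\widetilde H_{k_0+1})_{[v]}-\mathrm{id}\big)$ on $T_{[v]}\mathbb{CP}^{m-1}$. $[v]$ is fully attractive if all directors have strictly positive real part (vacuous for $m=1$). A representative $v$ is normalized if $H_{k_0+1}(v)=-\frac1{k_0}v$. Attracting conditions. These presuppose $k_0<\infty$. $F$ is $(f,v)$-attracting-non-degenerate if $v$ is a normalized representative of a fully attractive non-degenerate characteristic direction of the parabolic shadow $f$. It is $(f,v)$-parabolically attracting if moreover $$\mathrm{Re}\Big(\sum_{K\in\mathbb{N}^m,\,|K|=k_0}\frac{a_{K,j}}{\lambda_j}v^K\Big)<0,\qquad j=1,\dots,r.$$ $F$ is attracting-non-degenerate (resp. parabolically attracting) if it is $(f,v)$-attracting-non-degenerate (resp. $(f,v)$-parabolically attracting) for some parabolic shadow $f$ and some such $v$. *)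

theory Defs
  imports
    "HOL-Analysis.Analysis"
    "HOL-Library.Function_Algebras"
    "HOL-Library.Extended_Nat"
begin

section \<open>Multi-indices and formal power series in several variables\<close>

text \<open>
  A multi-index over a finite index type is a function into \<^typ>\<open>nat\<close>; addition and zero are
  the pointwise ones of \<^theory>\<open>HOL-Library.Function_Algebras\<close>.
\<close>

definition mdeg :: "('n::finite \<Rightarrow> nat) \<Rightarrow> nat"
  where "mdeg Q = (\<Sum>h\<in>UNIV. Q h)"

definition munit :: "'n \<Rightarrow> 'n \<Rightarrow> nat"
  where "munit j = (\<lambda>h. if h = j then 1 else 0)"

text \<open>The same type as \<^typ>\<open>complex ^ 'n\<close>; this form admits index types of a smaller sort.\<close>

type_synonym 'n cvec = "(complex, 'n) vec"

definition mpower :: "'n cvec \<Rightarrow> ('n::finite \<Rightarrow> nat) \<Rightarrow> complex"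
  where "mpower z Q = (\<Prod>h\<in>UNIV. (z $ h) ^ Q h)"

lemma finite_mdeg_le: "finite {Q :: 'n::finite \<Rightarrow> nat. mdeg Q \<le> d}"
proof (rule finite_subset)
  show "{Q :: 'n \<Rightarrow> nat. mdeg Q \<le> d} \<subseteq> PiE UNIV (\<lambda>_. {..d})"
  proof
    fix Q :: "'n \<Rightarrow> nat" assume "Q \<in> {Q. mdeg Q \<le> d}"
    then have "Q h \<le> d" for h
      using member_le_sum[of h UNIV Q] by (simp add: mdeg_def)
    then show "Q \<in> PiE UNIV (\<lambda>_. {..d})" by auto
  qed
  show "finite (PiE (UNIV :: 'n set) (\<lambda>_. {..d}))" by (intro finite_PiE) auto
qed

lemma mdeg_add: "mdeg (A + B) = mdeg A + mdeg B"
  by (simp add: mdeg_def sum.distrib)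

lemma finite_antidiagonal: "finite {(A, B :: 'n::finite \<Rightarrow> nat). A + B = Q}"
proof (rule finite_subset)
  show "{(A, B). A + B = Q} \<subseteq> {A. mdeg A \<le> mdeg Q} \<times> {B. mdeg B \<le> mdeg Q}"
    by (auto simp: mdeg_add)
qed (simp add: finite_mdeg_le)

typedef ('n, 'a) mfps = "UNIV :: (('n \<Rightarrow> nat) \<Rightarrow> 'a) set"
  morphisms mcoeff Abs_mfps ..

lemma mcoeff_Abs [simp]: "mcoeff (Abs_mfps f) = f"
  by (simp add: Abs_mfps_inverse)

lemma mfps_eqI: "(\<And>Q. mcoeff f Q = mcoeff g Q) \<Longrightarrow> f = g"
  by (metis ext mcoeff_inject)

instantiation mfps :: (finite, comm_ring_1) comm_ring_1
begin

definition "0 = Abs_mfps (\<lambda>_. 0)"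
definition "1 = Abs_mfps (\<lambda>Q. if Q = 0 then 1 else 0)"
definition "f + g = Abs_mfps (\<lambda>Q. mcoeff f Q + mcoeff g Q)"
definition "f - g = Abs_mfps (\<lambda>Q. mcoeff f Q - mcoeff g Q)"
definition "- f = Abs_mfps (\<lambda>Q. - mcoeff f Q)"
definition "f * g = Abs_mfps (\<lambda>Q. \<Sum>(A, B)\<in>{(A, B). A + B = Q}. mcoeff f A * mcoeff g B)"

instance
proof
  fix f g h :: "('a, 'b) mfps"
  show "f * g * h = f * (g * h)"
  proof (rule mfps_eqI)
    fix Q :: "'a \<Rightarrow> nat"
    have "mcoeff (f * g * h) Q =
        (\<Sum>p\<in>{(D, C). D + C = Q}. \<Sum>q\<in>{(A, B). A + B = fst p}.
           mcoeff f (fst q) * mcoeff g (snd q) * mcoeff h (snd p))"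
      by (simp add: times_mfps_def case_prod_unfold sum_distrib_right)
    also have "\<dots> = (\<Sum>x\<in>(SIGMA p:{(D, C). D + C = Q}. {(A, B). A + B = fst p}).
           mcoeff f (fst (snd x)) * mcoeff g (snd (snd x)) * mcoeff h (snd (fst x)))"
      by (subst sum.Sigma) (use finite_antidiagonal in \<open>auto simp: case_prod_unfold\<close>)
    also have "\<dots> = (\<Sum>x\<in>(SIGMA p:{(A, D). A + D = Q}. {(B, C). B + C = snd p}).
           mcoeff f (fst (fst x)) * mcoeff g (fst (snd x)) * mcoeff h (snd (snd x)))"
      by (rule sum.reindex_bij_witness
            [of _ "\<lambda>((A, D), (B, C)). ((A + B, C), (A, B))"
                  "\<lambda>((D, C), (A, B)). ((A, B + C), (B, C))"])
         (auto simp: add.assoc)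
    also have "\<dots> = (\<Sum>p\<in>{(A, D). A + D = Q}. \<Sum>q\<in>{(B, C). B + C = snd p}.
           mcoeff f (fst p) * (mcoeff g (fst q) * mcoeff h (snd q)))"
      by (subst sum.Sigma) (use finite_antidiagonal in \<open>auto simp: case_prod_unfold mult.assoc\<close>)
    also have "\<dots> = mcoeff (f * (g * h)) Q"
      by (simp add: times_mfps_def case_prod_unfold sum_distrib_left)
    finally show "mcoeff (f * g * h) Q = mcoeff (f * (g * h)) Q" .
  qed
  show "f * g = g * f"
  proof (rule mfps_eqI)
    fix Q :: "'a \<Rightarrow> nat"
    show "mcoeff (f * g) Q = mcoeff (g * f) Q"
      unfolding times_mfps_def mcoeff_Abs
      by (rule sum.reindex_bij_witness[of _ prod.swap prod.swap])
         (auto simp: add.commute mult.commute)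
  qed
  show "1 * f = f"
  proof (rule mfps_eqI)
    fix Q :: "'a \<Rightarrow> nat"
    have "mcoeff (1 * f) Q =
        (\<Sum>(A, B)\<in>{(A, B). A + B = Q}. if A = 0 then mcoeff f B else 0)"
      by (auto simp: times_mfps_def one_mfps_def intro!: sum.cong)
    also have "\<dots> = (\<Sum>(A, B)\<in>{(0 :: 'a \<Rightarrow> nat, Q)}. if A = 0 then mcoeff f B else 0)"
      using finite_antidiagonal[of Q] by (intro sum.mono_neutral_right) (simp, auto, meson+)
    finally show "mcoeff (1 * f) Q = mcoeff f Q" by simp
  qed
  show "(f + g) * h = f * h + g * h"
    by (rule mfps_eqI)
       (simp add: times_mfps_def plus_mfps_def case_prod_unfold distrib_right sum.distrib)
  show "(0 :: ('a, 'b) mfps) \<noteq> 1"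
  proof
    assume "(0 :: ('a, 'b) mfps) = 1"
    then have "mcoeff (0 :: ('a, 'b) mfps) 0 = mcoeff 1 0" by simp
    then show False by (simp add: zero_mfps_def one_mfps_def)
  qed
qed (rule mfps_eqI; simp add: plus_mfps_def zero_mfps_def minus_mfps_def uminus_mfps_def)+

end

text \<open>
  Substitution. Only used when all series \<open>G h\<close> have vanishing constant term; then
  \<open>\<Prod>h. G h ^ A h\<close> has no terms of degree below \<open>mdeg A\<close>, so that the truncation to
  \<open>mdeg A \<le> mdeg Q\<close> discards only zeros.
\<close>

definition mfps_compose ::
    "('n::finite, complex) mfps \<Rightarrow> ('n \<Rightarrow> ('n, complex) mfps) \<Rightarrow> ('n, complex) mfps"
  where "mfps_compose f G = Abs_mfps (\<lambda>Q.
           \<Sum>A\<in>{A. mdeg A \<le> mdeg Q}. mcoeff f A * mcoeff (\<Prod>h\<in>UNIV. G h ^ A h) Q)"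

type_synonym 'n formal_map = "'n \<Rightarrow> ('n, complex) mfps"

definition formal_compose ::
    "'n::finite formal_map \<Rightarrow> 'n formal_map \<Rightarrow> 'n formal_map"
  where "formal_compose \<Phi> \<Psi> = (\<lambda>j. mfps_compose (\<Phi> j) \<Psi>)"

text \<open>\<open>\<Phi>(z) = Diag(\<lambda>\<^sub>1,\<dots>,\<lambda>\<^sub>n) z + O(\<parallel>z\<parallel>\<^sup>2)\<close>\<close>

definition has_diagonal_part :: "'n::finite cvec \<Rightarrow> 'n formal_map \<Rightarrow> bool"
  where "has_diagonal_part lam \<Phi> \<longleftrightarrow>
    (\<forall>j Q. mdeg Q \<le> 1 \<longrightarrow> mcoeff (\<Phi> j) Q = (if Q = munit j then lam $ j else 0))"

definition tangent_to_identity :: "'n::finite formal_map \<Rightarrow> bool"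
  where "tangent_to_identity \<Phi> \<longleftrightarrow> has_diagonal_part (\<chi> j. 1) \<Phi>"


section \<open>Germs of biholomorphisms\<close>

text \<open>
  Germs are represented by total functions of which only the values near the origin matter.
  A germ is holomorphic if it is the sum of a convergent power series in a neighbourhood of \<open>0\<close>.
\<close>

definition has_taylor_series ::
    "('n::finite cvec \<Rightarrow> 'n cvec) \<Rightarrow> 'n formal_map \<Rightarrow> bool"
  where "has_taylor_series F T \<longleftrightarrow>
    (\<exists>\<epsilon>>0. \<forall>z. norm z < \<epsilon> \<longrightarrow>
       (\<forall>j. ((\<lambda>Q. mcoeff (T j) Q * mpower z Q) has_sum (F z $ j)) UNIV))"

definition holomorphic_germ :: "('n::finite cvec \<Rightarrow> 'n cvec) \<Rightarrow> bool"
  where "holomorphic_germ F \<longleftrightarrow> (\<exists>T. has_taylor_series F T)"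

text \<open>\<open>F\<close> is a germ of biholomorphism fixing \<open>0\<close>, and \<open>G\<close> is the germ of its inverse.\<close>

definition biholomorphic_germ_inverse ::
    "('n::finite cvec \<Rightarrow> 'n cvec) \<Rightarrow> ('n cvec \<Rightarrow> 'n cvec) \<Rightarrow> bool"
  where "biholomorphic_germ_inverse F G \<longleftrightarrow>
    holomorphic_germ F \<and> holomorphic_germ G \<and> F 0 = 0 \<and> G 0 = 0 \<and>
    (\<forall>\<^sub>F z in nhds 0. G (F z) = z) \<and> (\<forall>\<^sub>F z in nhds 0. F (G z) = z)"

definition has_diagonal_differential ::
    "'n::finite cvec \<Rightarrow> ('n cvec \<Rightarrow> 'n cvec) \<Rightarrow> bool"
  where "has_diagonal_differential lam F \<longleftrightarrow>
    (F has_derivative (\<lambda>z. \<chi> j. lam $ j * z $ j)) (at 0)"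


definition inverse_eigenvalues :: "'n::finite cvec \<Rightarrow> 'n cvec"
  where "inverse_eigenvalues lam = (\<chi> j. inverse (lam $ j))"


section \<open>Resonances\<close>

text \<open>
  Coordinates of \<open>\<complex>\<^sup>n\<close> are indexed by a finite linearly ordered type, so that ``the first \<open>r\<close>
  eigenvalues'' makes sense. The generators of the resonances are indexed by a finite type \<open>'m\<close>
  with \<open>m = CARD('m)\<close>, which is also the index type of the coordinates of \<open>\<complex>\<^sup>m\<close>.
\<close>

definition first :: "nat \<Rightarrow> 'n::{finite,linorder} set"
  where "first r = {j. card {i. i < j} < r}"

definition resonance :: "'n::finite cvec \<Rightarrow> 'n \<Rightarrow> ('n \<Rightarrow> nat) \<Rightarrow> bool"
  where "resonance lam j L \<longleftrightarrow> mdeg L \<ge> 2 \<and> lam $ j = mpower lam L"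

definition mcomb :: "('m::finite \<Rightarrow> 'n \<Rightarrow> nat) \<Rightarrow> ('m \<Rightarrow> nat) \<Rightarrow> 'n \<Rightarrow> nat"
  where "mcomb P K = (\<lambda>h. \<Sum>t\<in>UNIV. K t * P t h)"

definition resonance_generators ::
    "nat \<Rightarrow> 'n::{finite,linorder} cvec \<Rightarrow> ('m::finite \<Rightarrow> 'n \<Rightarrow> nat) \<Rightarrow> bool"
  where "resonance_generators r lam P \<longleftrightarrow>
    (\<forall>t. \<forall>h. h \<notin> first r \<longrightarrow> P t h = 0) \<and>
    inj P \<and> vec.independent (range (\<lambda>t. \<chi> h. rat_of_nat (P t h))) \<and>
    (\<forall>j\<in>first r. \<forall>L. resonance lam j L \<longleftrightarrow> (\<exists>K. K \<noteq> 0 \<and> L = munit j + mcomb P K))"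

definition m_resonant ::
    "'m::finite itself \<Rightarrow> nat \<Rightarrow> 'n::{finite,linorder} cvec \<Rightarrow>
     ('n cvec \<Rightarrow> 'n cvec) \<Rightarrow> bool"
  where "m_resonant (_ :: 'm itself) r lam F \<longleftrightarrow>
    has_diagonal_differential lam F \<and>
    (\<exists>P :: 'm \<Rightarrow> 'n \<Rightarrow> nat. resonance_generators r lam P)"


section \<open>Poincare-Dulac normal forms and the weighted order\<close>

text \<open>
  The coefficient \<open>a\<^bsub>K,s\<^esub>\<close> of \<open>z\<^bsup>KP\<^esup> z\<^sub>s\<close> in the \<open>s\<close>-th component; since the generators are linearly
  independent, different \<open>K\<close> give different monomials.
\<close>

definition res_coeff ::
    "('m::finite \<Rightarrow> 'n \<Rightarrow> nat) \<Rightarrow> 'n formal_map \<Rightarrow> ('m \<Rightarrow> nat) \<Rightarrow> 'n \<Rightarrow> complex"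
  where "res_coeff P N K s = mcoeff (N s) (munit s + mcomb P K)"

text \<open>
  Only the first \<open>r\<close> components are restricted to resonant monomials; of the remaining components
  nothing but \<open>R\<^sub>s = O(\<parallel>z\<parallel>\<^sup>2)\<close> is required.
\<close>

definition normal_form_shape ::
    "nat \<Rightarrow> 'n::{finite,linorder} cvec \<Rightarrow> ('m::finite \<Rightarrow> 'n \<Rightarrow> nat) \<Rightarrow> 'n formal_map \<Rightarrow> bool"
  where "normal_form_shape r lam P N \<longleftrightarrow>
    has_diagonal_part lam N \<and>
    (\<forall>s\<in>first r. \<forall>Q. mdeg Q \<ge> 2 \<longrightarrow> mcoeff (N s) Q \<noteq> 0 \<longrightarrow>
       (\<exists>K. K \<noteq> 0 \<and> Q = munit s + mcomb P K))"

text \<open>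
  \<open>N\<close> is a formal Poincare-Dulac normal form of \<open>F\<close>, where \<open>P\<close> are generators of the resonances;
  the conjugation \<open>\<Phi>\<inverse> \<circ> F \<circ> \<Phi> = N\<close> is written without the formal inverse.
\<close>

definition poincare_dulac_nf ::
    "nat \<Rightarrow> 'n::{finite,linorder} cvec \<Rightarrow> ('n cvec \<Rightarrow> 'n cvec) \<Rightarrow>
     ('m::finite \<Rightarrow> 'n \<Rightarrow> nat) \<Rightarrow> 'n formal_map \<Rightarrow> bool"
  where "poincare_dulac_nf r lam F P N \<longleftrightarrow>
    resonance_generators r lam P \<and> normal_form_shape r lam P N \<and>
    (\<exists>T \<Phi>. has_taylor_series F T \<and> tangent_to_identity \<Phi> \<and>
       formal_compose T \<Phi> = formal_compose \<Phi> N)"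

text \<open>The infimum of the empty set is \<open>\<infinity>\<close>.\<close>

definition nf_order ::
    "nat \<Rightarrow> ('m::finite \<Rightarrow> 'n::{finite,linorder} \<Rightarrow> nat) \<Rightarrow> 'n formal_map \<Rightarrow> enat"
  where "nf_order r P N =
    Inf {enat (mdeg K) | K s. mdeg K \<ge> 1 \<and> s \<in> first r \<and> res_coeff P N K s \<noteq> 0}"

text \<open>
  The weighted order of the germ \<open>F\<close> is the common order of all its normal forms (it is known
  that they exist and all have the same order).
\<close>

definition has_weighted_order ::
    "'m::finite itself \<Rightarrow> nat \<Rightarrow> 'n::{finite,linorder} cvec \<Rightarrow>
     ('n cvec \<Rightarrow> 'n cvec) \<Rightarrow> enat \<Rightarrow> bool"
  where "has_weighted_order (_ :: 'm itself) r lam F k \<longleftrightarrow>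
    (\<exists>(P :: 'm \<Rightarrow> 'n \<Rightarrow> nat) N. poincare_dulac_nf r lam F P N) \<and>
    (\<forall>(P :: 'm \<Rightarrow> 'n \<Rightarrow> nat) N. poincare_dulac_nf r lam F P N \<longrightarrow> nf_order r P N = k)"


section \<open>The parabolic shadow\<close>

text \<open>The homogeneous part \<open>H\<^bsub>k+1\<^esub>\<close> and the map \<open>f(u) = u + H\<^bsub>k+1\<^esub>(u)\<close> of \<open>\<complex>\<^sup>m\<close>.\<close>

definition shadow_part ::
    "nat \<Rightarrow> 'n::{finite,linorder} cvec \<Rightarrow> ('m::finite \<Rightarrow> 'n \<Rightarrow> nat) \<Rightarrow> 'n formal_map \<Rightarrow>
     nat \<Rightarrow> 'm cvec \<Rightarrow> 'm cvec"
  where "shadow_part r lam P N k u = (\<chi> t. u $ t *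
    (\<Sum>K\<in>{K. mdeg K = k}.
       (\<Sum>h\<in>first r. of_nat (P t h) * (res_coeff P N K h / lam $ h)) * mpower u K))"

definition parabolic_shadow ::
    "nat \<Rightarrow> 'n::{finite,linorder} cvec \<Rightarrow> ('m::finite \<Rightarrow> 'n \<Rightarrow> nat) \<Rightarrow> 'n formal_map \<Rightarrow>
     nat \<Rightarrow> 'm cvec \<Rightarrow> 'm cvec"
  where "parabolic_shadow r lam P N k = (\<lambda>u. u + shadow_part r lam P N k u)"


section \<open>Characteristic directions of \<open>f = id + H\<close>, with \<open>H\<close> homogeneous of degree \<open>k + 1\<close>\<close>

definition nondegenerate_char_direction ::
    "('m::finite cvec \<Rightarrow> 'm cvec) \<Rightarrow> 'm cvec \<Rightarrow> bool"
  where "nondegenerate_char_direction f v \<longleftrightarrow>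
    v \<noteq> 0 \<and> (\<exists>\<tau>. \<tau> \<noteq> 0 \<and> f v - v = \<tau> *s v)"

text \<open>
  The affine chart \<open>{[x] | x\<^sub>i \<noteq> 0}\<close> of the projective space is identified with the affine
  hyperplane \<open>{x | x\<^sub>i = 1}\<close> through \<open>x \<mapsto> x / x\<^sub>i\<close>. There the self-map \<open>[x] \<mapsto> [H x]\<close> reads
  \<open>x \<mapsto> H x / (H x)\<^sub>i\<close>, and the tangent space is \<open>{w | w\<^sub>i = 0}\<close>, which the differential preserves.
\<close>

definition affine_chart :: "'m \<Rightarrow> 'm::finite cvec \<Rightarrow> 'm cvec"
  where "affine_chart i x = inverse (x $ i) *s x"

definition is_director ::
    "nat \<Rightarrow> ('m::finite cvec \<Rightarrow> 'm cvec) \<Rightarrow> 'm cvec \<Rightarrow> complex \<Rightarrow> bool"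
  where "is_director k f v \<delta> \<longleftrightarrow>
    (\<exists>i L w. v $ i \<noteq> 0 \<and>
       ((\<lambda>x. affine_chart i (f x - x)) has_derivative L) (at (affine_chart i v)) \<and>
       w \<noteq> 0 \<and> w $ i = 0 \<and> inverse (of_nat k) *s (L w - w) = \<delta> *s w)"

definition fully_attractive ::
    "nat \<Rightarrow> ('m::finite cvec \<Rightarrow> 'm cvec) \<Rightarrow> 'm cvec \<Rightarrow> bool"
  where "fully_attractive k f v \<longleftrightarrow> (\<forall>\<delta>. is_director k f v \<delta> \<longrightarrow> Re \<delta> > 0)"

definition normalized_representative ::
    "nat \<Rightarrow> ('m::finite cvec \<Rightarrow> 'm cvec) \<Rightarrow> 'm cvec \<Rightarrow> bool"
  where "normalized_representative k f v \<longleftrightarrow> f v - v = (- inverse (of_nat k)) *s v"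


section \<open>Attracting conditions\<close>

definition attracting_nondegenerate_at ::
    "nat \<Rightarrow> 'n::{finite,linorder} cvec \<Rightarrow> ('n cvec \<Rightarrow> 'n cvec) \<Rightarrow>
     ('m::finite \<Rightarrow> 'n \<Rightarrow> nat) \<Rightarrow> 'n formal_map \<Rightarrow> nat \<Rightarrow>
     ('m cvec \<Rightarrow> 'm cvec) \<Rightarrow> 'm cvec \<Rightarrow> bool"
  where "attracting_nondegenerate_at r lam F P N k f v \<longleftrightarrow>
    poincare_dulac_nf r lam F P N \<and> nf_order r P N = enat k \<and>
    f = parabolic_shadow r lam P N k \<and>
    nondegenerate_char_direction f v \<and> fully_attractive k f v \<and> normalized_representative k f v"

definition parabolically_attracting_at ::
    "nat \<Rightarrow> 'n::{finite,linorder} cvec \<Rightarrow> ('n cvec \<Rightarrow> 'n cvec) \<Rightarrow>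
     ('m::finite \<Rightarrow> 'n \<Rightarrow> nat) \<Rightarrow> 'n formal_map \<Rightarrow> nat \<Rightarrow>
     ('m cvec \<Rightarrow> 'm cvec) \<Rightarrow> 'm cvec \<Rightarrow> bool"
  where "parabolically_attracting_at r lam F P N k f v \<longleftrightarrow>
    attracting_nondegenerate_at r lam F P N k f v \<and>
    (\<forall>j\<in>first r. Re (\<Sum>K\<in>{K. mdeg K = k}. res_coeff P N K j / lam $ j * mpower v K) < 0)"

definition attracting_nondegenerate ::
    "'m::finite itself \<Rightarrow> nat \<Rightarrow> 'n::{finite,linorder} cvec \<Rightarrow>
     ('n cvec \<Rightarrow> 'n cvec) \<Rightarrow> bool"
  where "attracting_nondegenerate (_ :: 'm itself) r lam F \<longleftrightarrow>
    (\<exists>(P :: 'm \<Rightarrow> 'n \<Rightarrow> nat) N k f v. attracting_nondegenerate_at r lam F P N k f v)"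

definition parabolically_attracting ::
    "'m::finite itself \<Rightarrow> nat \<Rightarrow> 'n::{finite,linorder} cvec \<Rightarrow>
     ('n cvec \<Rightarrow> 'n cvec) \<Rightarrow> bool"
  where "parabolically_attracting (_ :: 'm itself) r lam F \<longleftrightarrow>
    (\<exists>(P :: 'm \<Rightarrow> 'n \<Rightarrow> nat) N k f v. parabolically_attracting_at r lam F P N k f v)"

end

theory Submission
  imports Defs "HOL-Library.Landau_Symbols"
begin

text \<open>
  Let \<open>\<Phi>\<close> conjugate \<open>F\<close> to a normal form \<open>N\<close>. The same \<open>\<Phi>\<close> conjugates the inverse germ \<open>G\<close> to the formal
  inverse \<open>M\<close> of \<open>N\<close> (lemma \<open>poincare_dulac_nf_inverse\<close>), and \<open>M\<close> is again a normal form with the same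
  generators: the resonances of \<open>\<lambda>\<close> and of \<open>\<lambda>\<inverse>\<close> are the same, and solving \<open>N \<circ> M = id\<close> degree by degree
  produces in the first \<open>r\<close> components only monomials \<open>z\<^bsup>KP\<^esup> z\<^sub>s\<close>, because
  substituting for each \<open>z\<^sub>h\<close> in such a monomial a multiple of \<open>z\<^sub>h\<close> by a series in the \<open>z\<^bsup>KP\<^esup>\<close> gives a multiple of
  \<open>z\<^sub>s\<close> by a series in the \<open>z\<^bsup>KP\<^esup>\<close> (lemma \<open>normal_form_shape_inverse\<close>).

  Up to the weighted order \<open>k\<close>, comparing coefficients in \<open>N \<circ> M = id\<close> relates the coefficients
  \<open>a\<^bsub>K,s\<^esub>\<close> of \<open>N\<close> to the coefficients \<open>b\<^bsub>K,s\<^esub>\<close> of \<open>M\<close> by \<open>b\<^bsub>K,s\<^esub> = - a\<^bsub>K,s\<^esub> / \<lambda>\<^sub>s\<^sup>2\<close> (lemma \<open>res_coeff_inverse\<close>).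
  Hence the order is the same, and as \<open>b\<^bsub>K,s\<^esub> / \<lambda>\<^sub>s\<inverse> = - a\<^bsub>K,s\<^esub> / \<lambda>\<^sub>s\<close>, the parabolic shadow \<open>u + H(u)\<close> turns into
  \<open>u - H(u)\<close>. Characteristic directions and directors are those of the map that \<open>H\<close> induces on the
  projective space, which does not see the sign. A normalized representative \<open>v\<close> becomes normalized again after
  multiplication by a \<open>k\<close>-th root of \<open>-1\<close>, and the same factor compensates the sign in the inequality of
  parabolic attraction. Every normal form of \<open>G\<close> arises in this way, by exchanging the germs.

  The remaining work is to connect germs with formal maps and to establish the laws of formal
  composition. Both are reduced to asymptotic expansions \<open>f(z) = \<Sum>\<^bsub>|Q|\<le>d\<^esub> T\<^sub>Q z\<^sup>Q + O(\<parallel>z\<parallel>\<^bsup>d+1\<^esup>)\<close>: these are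
  unique (\<open>has_jet_unique\<close>) and composition of functions expands to composition of series
  (\<open>has_jet_compose\<close>). Applied to the germs this gives that their Taylor series are
  formally inverse; applied to polynomial truncations of formal series it gives the associative law.
\<close>

section \<open>Monomials\<close>

lemma mdeg_zero [simp]: "mdeg 0 = 0"
  by (simp add: mdeg_def)

lemma mdeg_munit [simp]: "mdeg (munit j) = 1"
  by (simp add: mdeg_def munit_def)

lemma mdeg_eq_0_iff: "mdeg Q = 0 \<longleftrightarrow> Q = 0"
  by (auto simp: mdeg_def fun_eq_iff)

lemma mpower_zero [simp]: "mpower z 0 = 1"
  by (simp add: mpower_def)

lemma mpower_add: "mpower z (A + B) = mpower z A * mpower z B"
  by (simp add: mpower_def power_add prod.distrib)

lemma mpower_munit [simp]: "mpower z (munit j) = z $ j"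
proof -
  have "mpower z (munit j) = (\<Prod>h\<in>UNIV. if h = j then z $ h else 1)"
    unfolding mpower_def munit_def by (rule prod.cong) auto
  then show ?thesis by simp
qed

lemma mpower_scale: "mpower (c *s z) Q = c ^ mdeg Q * mpower z Q"
  by (simp add: mpower_def mdeg_def power_mult_distrib prod.distrib power_sum)

lemma norm_mpower_le: "norm (mpower z Q) \<le> norm z ^ mdeg Q"
proof -
  have "norm (mpower z Q) = (\<Prod>h\<in>UNIV. norm (z $ h) ^ Q h)"
    by (simp add: mpower_def prod_norm [symmetric] norm_power)
  also have "\<dots> \<le> (\<Prod>h\<in>UNIV. norm z ^ Q h)"
    by (intro prod_mono) (auto intro!: power_mono simp: Finite_Cartesian_Product.norm_nth_le)
  finally show ?thesis by (simp add: mdeg_def power_sum)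
qed

text \<open>
  The induction is on the set of variables in which the exponents may differ: a new variable
  splits the sum by its exponent, and a univariate polynomial that vanishes identically has
  vanishing coefficients.
\<close>

lemma polynomial_coeffs_zero:
  fixes c :: "('n::finite \<Rightarrow> nat) \<Rightarrow> complex"
  assumes "finite S" and "\<And>z. (\<Sum>Q\<in>S. c Q * mpower z Q) = 0" and "Q \<in> S"
  shows "c Q = 0"
proof -
  have "\<forall>Q\<in>S. c Q = 0" if "finite V" "finite S" "\<forall>z. (\<Sum>Q\<in>S. c Q * mpower z Q) = 0"
      "\<forall>Q\<in>S. \<forall>Q'\<in>S. \<forall>h. h \<notin> V \<longrightarrow> Q h = Q' h" for V S
    using that
  proof (induction V arbitrary: S rule: finite_induct)
    case empty
    show ?case
    proof
      fix Q assume "Q \<in> S"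
      with empty have "S = {Q}" by auto
      with empty(2)[rule_format, of "\<chi> h. 1"] show "c Q = 0" by (simp add: mpower_def)
    qed
  next
    case (insert i V)
    define n where "n = Max (insert 0 ((\<lambda>Q. Q i) ` S))"
    have n: "Q i \<le> n" if "Q \<in> S" for Q
      unfolding n_def using that insert.prems(1) by (intro Max_ge) auto
    have part: "(\<Sum>Q\<in>{Q \<in> S. Q i = k}. c Q * mpower z Q) = 0" if "k \<le> n" for k z
    proof -
      define p where "p k = (\<Sum>Q\<in>{Q \<in> S. Q i = k}. c Q * (\<Prod>h\<in>UNIV - {i}. (z $ h) ^ Q h))" for k
      have "(\<Sum>k\<le>n. p k * w ^ k) = 0" for w
      proof -
        define z' where "z' = (\<chi> h. if h = i then w else z $ h)"
        have mp: "mpower z' Q = (\<Prod>h\<in>UNIV - {i}. (z $ h) ^ Q h) * w ^ Q i" for Q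
        proof -
          have "mpower z' Q = (z' $ i) ^ Q i * (\<Prod>h\<in>UNIV - {i}. (z' $ h) ^ Q h)"
            unfolding mpower_def by (rule prod.remove) auto
          also have "(\<Prod>h\<in>UNIV - {i}. (z' $ h) ^ Q h) = (\<Prod>h\<in>UNIV - {i}. (z $ h) ^ Q h)"
            by (rule prod.cong) (auto simp: z'_def)
          finally show ?thesis by (simp add: z'_def)
        qed
        have "(\<Sum>k\<le>n. p k * w ^ k) =
            (\<Sum>k\<le>n. \<Sum>Q\<in>{Q \<in> S. Q i = k}. c Q * mpower z' Q)"
          by (intro sum.cong refl) (auto simp: p_def mp sum_distrib_right mult.assoc intro!: sum.cong)
        also have "\<dots> = (\<Sum>Q\<in>S. c Q * mpower z' Q)"
          using n insert.prems(1) by (intro sum.group) auto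
        finally show ?thesis using insert.prems(2) by simp
      qed
      then have "p k = 0" using polyfun_eq_0[of p n] \<open>k \<le> n\<close> by blast
      moreover have "(\<Sum>Q\<in>{Q \<in> S. Q i = k}. c Q * mpower z Q) = p k * (z $ i) ^ k"
        unfolding p_def sum_distrib_right mpower_def
        by (intro sum.cong refl) (subst prod.remove[of _ i], auto)
      ultimately show ?thesis by simp
    qed
    have "\<forall>Q\<in>{Q \<in> S. Q i = k}. c Q = 0" if "k \<le> n" for k
    proof (rule insert.IH)
      show "\<forall>Q\<in>{Q \<in> S. Q i = k}. \<forall>Q'\<in>{Q \<in> S. Q i = k}. \<forall>h. h \<notin> V \<longrightarrow> Q h = Q' h"
      proof (intro ballI allI impI)
        fix Q Q' h assume "Q \<in> {Q \<in> S. Q i = k}" "Q' \<in> {Q \<in> S. Q i = k}" "h \<notin> V"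
        then show "Q h = Q' h" using insert.prems(3) by (cases "h = i") auto
      qed
    qed (use insert.prems(1) part[OF that] in auto)
    with n show ?case by blast
  qed
  from this[of UNIV S] assms show ?thesis by auto
qed

section \<open>Asymptotic expansions at the origin\<close>

definition jet_poly :: "nat \<Rightarrow> ('n::finite, complex) mfps \<Rightarrow> 'n cvec \<Rightarrow> complex"
  where "jet_poly d T z = (\<Sum>Q | mdeg Q \<le> d. mcoeff T Q * mpower z Q)"

definition vanishing_order :: "nat \<Rightarrow> ('n::finite cvec \<Rightarrow> complex) set"
  where "vanishing_order d = O[nhds 0](\<lambda>z. complex_of_real (norm z ^ d))"

lemma vanishing_order_add:
  "f \<in> vanishing_order d \<Longrightarrow> g \<in> vanishing_order d \<Longrightarrow> (\<lambda>z. f z + g z) \<in> vanishing_order d"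
  unfolding vanishing_order_def by (rule sum_in_bigo)

lemma vanishing_order_diff:
  "f \<in> vanishing_order d \<Longrightarrow> g \<in> vanishing_order d \<Longrightarrow> (\<lambda>z. f z - g z) \<in> vanishing_order d"
  unfolding vanishing_order_def by (rule sum_in_bigo)

lemma vanishing_order_sum:
  "(\<And>i. i \<in> I \<Longrightarrow> f i \<in> vanishing_order d) \<Longrightarrow> (\<lambda>z. \<Sum>i\<in>I. f i z) \<in> vanishing_order d"
  unfolding vanishing_order_def by (rule big_sum_in_bigo)

lemma vanishing_order_cmult:
  "f \<in> vanishing_order d \<Longrightarrow> (\<lambda>z. c * f z) \<in> vanishing_order d"
  unfolding vanishing_order_def by (cases "c = 0") simp_all

lemma zero_vanishing_order [simp]: "(\<lambda>z. 0) \<in> vanishing_order d"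
  by (simp add: vanishing_order_def)

text \<open>
  As only the coefficients of \<open>T\<close> up to degree \<open>d\<close> enter, one notion serves both germs with their
  Taylor series and purely formal series, represented by their truncations. The filter \<open>nhds 0\<close>
  does not exclude the origin, so that \<open>f 0\<close> has to be the constant term of \<open>T\<close>.
\<close>

definition has_jet :: "nat \<Rightarrow> ('n::finite cvec \<Rightarrow> complex) \<Rightarrow> ('n, complex) mfps \<Rightarrow> bool"
  where "has_jet d f T \<longleftrightarrow> (\<lambda>z. f z - jet_poly d T z) \<in> vanishing_order (Suc d)"

lemma has_jet_jet_poly: "has_jet d (jet_poly d T) T"
  by (simp add: has_jet_def)

lemma has_jet_eventually_cong:
  assumes "eventually (\<lambda>z. f z = g z) (nhds 0)" and "has_jet d f T"
  shows "has_jet d g T"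
proof -
  have "(\<lambda>z. f z - jet_poly d T z) \<in> vanishing_order (Suc d) \<longleftrightarrow>
        (\<lambda>z. g z - jet_poly d T z) \<in> vanishing_order (Suc d)"
    unfolding vanishing_order_def
    by (rule landau_o.big.in_cong) (use assms(1) in eventually_elim, simp)
  with assms(2) show ?thesis by (simp add: has_jet_def)
qed

lemma vanishing_order_mono:
  assumes "f \<in> vanishing_order a" and "b \<le> a"
  shows "f \<in> vanishing_order b"
proof -
  have "(\<lambda>z :: 'a cvec. complex_of_real (norm z ^ a)) \<in> vanishing_order b"
    unfolding vanishing_order_def
  proof (rule bigoI[of _ 1])
    have "eventually (\<lambda>z :: 'a cvec. dist z 0 < 1) (nhds 0)"
      by (rule eventually_nhds_metric[THEN iffD2]) (auto intro: exI[of _ 1])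
    then show "\<forall>\<^sub>F z :: 'a cvec in nhds 0.
        norm (complex_of_real (norm z ^ a)) \<le> 1 * norm (complex_of_real (norm z ^ b))"
    proof eventually_elim
      case (elim z)
      then have "norm z ^ a \<le> norm z ^ b" using assms(2) by (intro power_decreasing) auto
      then show ?case by (simp add: norm_power)
    qed
  qed
  with assms(1) show ?thesis 
    unfolding vanishing_order_def using landau_o.big_trans by blast
qed

lemma vanishing_order_mult:
  assumes "f \<in> vanishing_order a" and "g \<in> vanishing_order b"
  shows "(\<lambda>z. f z * g z) \<in> vanishing_order (a + b)"
  using landau_o.big.mult[OF assms[unfolded vanishing_order_def]]
  by (simp add: vanishing_order_def power_add)

lemma mpower_vanishing_order: "(\<lambda>z. mpower z Q) \<in> vanishing_order (mdeg Q)"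
  unfolding vanishing_order_def by (rule bigoI[of _ 1]) (simp add: norm_mpower_le norm_power)

lemma monomial_vanishing_order:
  "b \<le> mdeg Q \<Longrightarrow> (\<lambda>z. c * mpower z Q) \<in> vanishing_order b"
  using vanishing_order_mono[OF mpower_vanishing_order] by (rule vanishing_order_cmult)

lemma jet_poly_vanishing_order:
  assumes "\<And>Q. mdeg Q < a \<Longrightarrow> mcoeff T Q = 0"
  shows "jet_poly d T \<in> vanishing_order a"
  unfolding jet_poly_def
proof (rule vanishing_order_sum)
  fix Q assume "Q \<in> {Q :: 'a \<Rightarrow> nat. mdeg Q \<le> d}"
  show "(\<lambda>z. mcoeff T Q * mpower z Q) \<in> vanishing_order a"
    by (cases "mdeg Q < a") (auto simp: assms intro: monomial_vanishing_order)
qed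

lemma has_jet_vanishing_order:
  assumes "has_jet d f T" and "\<And>Q. mdeg Q < a \<Longrightarrow> mcoeff T Q = 0" and "a \<le> Suc d"
  shows "f \<in> vanishing_order a"
proof -
  have "(\<lambda>z. (f z - jet_poly d T z) + jet_poly d T z) \<in> vanishing_order a"
    using assms unfolding has_jet_def
    by (intro vanishing_order_add jet_poly_vanishing_order) (auto intro: vanishing_order_mono)
  then show ?thesis by simp
qed

text \<open>
  The difference of the two truncations is a polynomial of degree at most \<open>d\<close> that is \<open>O(\<parallel>z\<parallel>\<^bsup>d+1\<^esup>)\<close>.
  On a line through the origin its lowest homogeneous part is a constant times \<open>t\<^bsup>k\<^esup>\<close> with
  \<open>k \<le> d\<close>, and so vanishes.
\<close>

lemma has_jet_unique:
  assumes "has_jet d f T" and "has_jet d f U" and "mdeg Q \<le> d"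
  shows "mcoeff T Q = mcoeff U Q"
proof -
  define c where "c Q = mcoeff U Q - mcoeff T Q" for Q
  have "(\<lambda>z. (f z - jet_poly d T z) - (f z - jet_poly d U z)) \<in> vanishing_order (Suc d)"
    using assms(1,2) unfolding has_jet_def by (rule vanishing_order_diff)
  then have c_poly: "(\<lambda>z. \<Sum>Q | mdeg Q \<le> d. c Q * mpower z Q) \<in> vanishing_order (Suc d)"
    by (simp add: jet_poly_def c_def left_diff_distrib sum_subtractf)
  have "c Q = 0" if "mdeg Q \<le> d" for Q
    using that
  proof (induction "mdeg Q" arbitrary: Q rule: less_induct)
    case less
    define k where "k = mdeg Q"
    have lower: "c Q' = 0" if "mdeg Q' < k" for Q'
      using less that by (simp add: k_def)
    define p where "p z = (\<Sum>Q | mdeg Q = k. c Q * mpower z Q)" for z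
    have fin: "finite {Q :: 'a \<Rightarrow> nat. mdeg Q = k}"
      by (rule finite_subset[OF _ finite_mdeg_le[of k]]) auto
    have split: "(\<Sum>Q | mdeg Q \<le> d. c Q * mpower z Q) =
        p z + (\<Sum>Q | k < mdeg Q \<and> mdeg Q \<le> d. c Q * mpower z Q)" for z
    proof -
      have "(\<Sum>Q | mdeg Q \<le> d. c Q * mpower z Q) =
          (\<Sum>Q\<in>{Q. mdeg Q = k} \<union> {Q. k < mdeg Q \<and> mdeg Q \<le> d}. c Q * mpower z Q)"
        using less.prems
        by (intro sum.mono_neutral_right)
          (auto simp: finite_mdeg_le k_def intro!: lower[unfolded k_def] dest: linorder_cases)
      also have "\<dots> = p z + (\<Sum>Q | k < mdeg Q \<and> mdeg Q \<le> d. c Q * mpower z Q)"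
        unfolding p_def using fin
        by (intro sum.union_disjoint) (auto intro: finite_subset[OF _ finite_mdeg_le[of d]])
      finally show ?thesis .
    qed
    have "(\<lambda>z. (\<Sum>Q | mdeg Q \<le> d. c Q * mpower z Q)
        - (\<Sum>Q | k < mdeg Q \<and> mdeg Q \<le> d. c Q * mpower z Q)) \<in> vanishing_order (Suc k)"
      using less.prems
      by (intro vanishing_order_diff vanishing_order_mono[OF c_poly] vanishing_order_sum
            monomial_vanishing_order) (auto simp: k_def)
    then have p_order: "p \<in> vanishing_order (Suc k)"
      by (simp add: split)
    have p_zero: "p w = 0" for w
    proof -
      have line: "complex_of_real t *s w = t *\<^sub>R w" for t
        by (simp only: vec_eq_iff vector_smult_component vector_scaleR_component
            scaleR_conv_of_real[symmetric] simp_thms)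
      have lim: "filterlim (\<lambda>t. complex_of_real t *s w) (nhds 0) (at_right 0)"
      proof -
        have "((\<lambda>t. t *\<^sub>R w) \<longlongrightarrow> 0 *\<^sub>R w) (at_right 0)"
          by (intro tendsto_intros)
        then show ?thesis by (simp add: line)
      qed
      have norm_line: "norm (complex_of_real t *s w) = \<bar>t\<bar> * norm w" for t
        by (simp add: line)
      from p_order[unfolded vanishing_order_def] lim have "(\<lambda>t. p (of_real t *s w)) \<in>
          O[at_right 0](\<lambda>t. complex_of_real (norm (complex_of_real t *s w) ^ Suc k))"
        by (rule landau_o.big.compose)
      then obtain C where C: "eventually (\<lambda>t. norm (p (of_real t *s w)) \<le>
          C * norm (complex_of_real (norm (complex_of_real t *s w) ^ Suc k))) (at_right 0)"
        by (auto elim: landau_o.bigE)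
      have hom: "p (of_real t *s w) = of_real t ^ k * p w" for t
        by (simp add: p_def mpower_scale sum_distrib_left mult_ac)
      have "eventually (\<lambda>t. norm (p w) \<le> C * norm w ^ Suc k * t) (at_right 0)"
        using C eventually_at_right_less[of "0 :: real"]
      proof eventually_elim
        case (elim t)
        then have "t ^ k * norm (p w) \<le> t ^ k * (C * norm w ^ Suc k * t)"
          by (simp add: hom norm_line norm_mult norm_power power_mult_distrib mult_ac)
        with elim show ?case by simp
      qed
      moreover have "((\<lambda>t. C * norm w ^ Suc k * t) \<longlongrightarrow> C * norm w ^ Suc k * 0) (at_right 0)"
        by (intro tendsto_intros)
      ultimately have "norm (p w) \<le> C * norm w ^ Suc k * 0"
        by (intro tendsto_lowerbound[where F = "at_right (0::real)"]) auto
      then show ?thesis by simp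
    qed
    show ?case
      by (rule polynomial_coeffs_zero[OF fin, of c]) (use p_zero in \<open>auto simp: p_def k_def\<close>)
  qed
  with assms(3) show ?thesis by (simp add: c_def)
qed

text \<open>
  Identities between formal series are proved below by exhibiting, for each degree, a function that
  has both sides as expansion.
\<close>

lemma mfps_eq_if_jets:
  assumes "\<And>d. \<exists>f. has_jet d f T \<and> has_jet d f U"
  shows "T = U"
  using assms has_jet_unique by (metis mfps_eqI order_refl)

text \<open>
  With \<open>p\<close>, \<open>q\<close> the truncations of \<open>f\<close>, \<open>g\<close>, the error splits as \<open>(f - p) g + p (g - q)\<close> plus the part of
  \<open>p q\<close> of degree above \<open>d\<close>.
\<close>

lemma has_jet_mult:
  assumes f: "has_jet d f T" and g: "has_jet d g U"
  shows "has_jet d (\<lambda>z. f z * g z) (T * U)"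
proof -
  define E where "E = {A :: 'a \<Rightarrow> nat. mdeg A \<le> d} \<times> {B :: 'a \<Rightarrow> nat. mdeg B \<le> d}"
  have finE: "finite E" by (simp add: E_def finite_mdeg_le)
  define tm where "tm = (\<lambda>z (A, B). mcoeff T A * mcoeff U B * mpower z (A + B))"
  have prod_poly: "jet_poly d T z * jet_poly d U z = sum (tm z) E" for z
    unfolding jet_poly_def E_def tm_def
    by (simp add: sum_product sum.cartesian_product mpower_add mult_ac)
  have poly_prod: "jet_poly d (T * U) z = sum (tm z) {(A, B) \<in> E. mdeg (A + B) \<le> d}" for z
  proof -
    have "sum (tm z) {(A, B) \<in> E. mdeg (A + B) \<le> d} =
        (\<Sum>Q | mdeg Q \<le> d. sum (tm z)
           {x \<in> {(A, B) \<in> E. mdeg (A + B) \<le> d}. fst x + snd x = Q})"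
      by (rule sum.group[symmetric])
        (auto simp: finite_mdeg_le intro: finite_subset[OF _ finE])
    also have "\<dots> = (\<Sum>Q | mdeg Q \<le> d. sum (tm z) {(A, B). A + B = Q})"
      by (intro sum.cong refl) (auto simp: E_def mdeg_add)
    also have "\<dots> = jet_poly d (T * U) z"
      unfolding jet_poly_def
      by (intro sum.cong refl)
        (auto simp: times_mfps_def tm_def sum_distrib_right intro!: sum.cong)
    finally show ?thesis by simp
  qed
  have rest: "(\<lambda>z. jet_poly d T z * jet_poly d U z - jet_poly d (T * U) z)
      \<in> vanishing_order (Suc d)"
  proof -
    have "sum (tm z) E - sum (tm z) {(A, B) \<in> E. mdeg (A + B) \<le> d} =
        sum (tm z) (E - {(A, B) \<in> E. mdeg (A + B) \<le> d})" for z
      by (rule sum_diff[symmetric]) (auto simp: finE)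
    moreover have "(\<lambda>z. sum (tm z) (E - {(A, B) \<in> E. mdeg (A + B) \<le> d}))
        \<in> vanishing_order (Suc d)"
      by (rule vanishing_order_sum)
        (auto simp: tm_def E_def intro!: monomial_vanishing_order)
    ultimately show ?thesis by (simp add: prod_poly poly_prod)
  qed
  have "(\<lambda>z. (f z - jet_poly d T z) * g z) \<in> vanishing_order (Suc d + 0)"
    using f has_jet_vanishing_order[OF g, of 0]
    by (intro vanishing_order_mult) (auto simp: has_jet_def)
  moreover have "(\<lambda>z. jet_poly d T z * (g z - jet_poly d U z)) \<in> vanishing_order (0 + Suc d)"
    using g by (intro vanishing_order_mult jet_poly_vanishing_order) (auto simp: has_jet_def)
  ultimately have "(\<lambda>z. ((f z - jet_poly d T z) * g z + jet_poly d T z * (g z - jet_poly d U z)) +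
      (jet_poly d T z * jet_poly d U z - jet_poly d (T * U) z)) \<in> vanishing_order (Suc d)"
    by (intro vanishing_order_add rest) auto
  then show ?thesis by (simp add: has_jet_def algebra_simps)
qed

lemma has_jet_one: "has_jet d (\<lambda>_. 1) 1"
proof -
  have "jet_poly d 1 z = (\<Sum>Q\<in>{0 :: 'a \<Rightarrow> nat}. 1)" for z :: "'a cvec"
    unfolding jet_poly_def
    by (rule sum.mono_neutral_cong_right) (auto simp: one_mfps_def finite_mdeg_le split: if_splits)
  then show ?thesis by (simp add: has_jet_def)
qed

lemma has_jet_power: "has_jet d f T \<Longrightarrow> has_jet d (\<lambda>z. f z ^ k) (T ^ k)"
  by (induction k) (auto intro: has_jet_one has_jet_mult)

lemma has_jet_prod:
  "finite I \<Longrightarrow> (\<And>i. i \<in> I \<Longrightarrow> has_jet d (f i) (T i)) \<Longrightarrow>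
    has_jet d (\<lambda>z. \<Prod>i\<in>I. f i z) (\<Prod>i\<in>I. T i)"
  by (induction I rule: finite_induct) (auto intro: has_jet_one has_jet_mult)

text \<open>
  Convergence at one point with all coordinates \<open>\<rho> > 0\<close> bounds the sum of all
  \<open>\<bar>T\<^sub>Q\<bar> \<rho>\<^bsup>|Q|\<^esup>\<close>, and a tail of terms of degree above \<open>d\<close> gains the factor
  \<open>(\<parallel>z\<parallel> / \<rho>)\<^bsup>d+1\<^esup>\<close> over this bound.
\<close>

lemma has_taylor_series_imp_has_jet:
  fixes F :: "'n::finite cvec \<Rightarrow> 'n cvec"
  assumes "has_taylor_series F T"
  shows "has_jet d (\<lambda>z. F z $ j) (T j)"
proof -
  from assms obtain \<epsilon> where \<epsilon>: "\<epsilon> > 0"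
    and sums: "\<And>z. norm z < \<epsilon> \<Longrightarrow> ((\<lambda>Q. mcoeff (T j) Q * mpower z Q) has_sum F z $ j) UNIV"
    unfolding has_taylor_series_def by blast
  define \<rho> where "\<rho> = \<epsilon> / (2 * real CARD('n))"
  have card: "real CARD('n) \<ge> 1"
    by (simp add: Suc_leI)
  have \<rho>: "\<rho> > 0" using \<epsilon> by (simp add: \<rho>_def)
  have \<rho>_card: "CARD('n) * \<rho> < \<epsilon>" using \<epsilon> card by (simp add: \<rho>_def field_simps)
  have \<rho>_less: "\<rho> < \<epsilon>"
    using mult_right_mono[OF card, of \<rho>] \<rho> \<rho>_card by linarith
  define w :: "'n cvec" where "w = (\<chi> h. of_real \<rho>)"
  have "norm w \<le> (\<Sum>h\<in>(UNIV :: 'n set). norm (w $ h))"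
    unfolding norm_vec_def by (rule L2_set_le_sum) simp
  then have "norm w < \<epsilon>" using \<rho>_card \<rho> by (simp add: w_def)
  have mpower_w: "mpower w Q = of_real (\<rho> ^ mdeg Q)" for Q
    by (simp add: mpower_def w_def mdeg_def power_sum)
  have "(\<lambda>Q. mcoeff (T j) Q * mpower w Q) summable_on UNIV"
    using sums[OF \<open>norm w < \<epsilon>\<close>] by (auto simp: summable_on_def)
  then have "(\<lambda>Q. norm (mcoeff (T j) Q * mpower w Q)) summable_on UNIV"
    by (simp only: summable_on_iff_abs_summable_on_complex)
  then have "(\<lambda>Q. norm (mcoeff (T j) Q) * \<rho> ^ mdeg Q) summable_on UNIV"
    using \<rho> by (simp add: mpower_w norm_mult norm_power)
  then obtain C where C: "((\<lambda>Q. norm (mcoeff (T j) Q) * \<rho> ^ mdeg Q) has_sum C) UNIV"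
    by (auto simp: summable_on_def)
  have bound: "norm (F z $ j - jet_poly d (T j) z) \<le> C * (norm z / \<rho>) ^ Suc d"
    if z: "norm z < \<rho>" for z
  proof -
    have head: "((\<lambda>Q. if mdeg Q \<le> d then mcoeff (T j) Q * mpower z Q else 0) has_sum
        jet_poly d (T j) z) UNIV"
      by (rule has_sum_finite_neutralI[of "{Q. mdeg Q \<le> d}"])
        (auto simp: finite_mdeg_le jet_poly_def)
    have diff: "((\<lambda>Q. mcoeff (T j) Q * mpower z Q -
        (if mdeg Q \<le> d then mcoeff (T j) Q * mpower z Q else 0)) has_sum
        F z $ j - jet_poly d (T j) z) UNIV"
      using has_sum_add[OF sums[of z] has_sum_uminusI[OF head]] z \<rho>_less by simp
    have majorant: "((\<lambda>Q. norm (mcoeff (T j) Q) * \<rho> ^ mdeg Q * (norm z / \<rho>) ^ Suc d) has_sum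
        C * (norm z / \<rho>) ^ Suc d) UNIV"
      using C by (rule has_sum_cmult_left)
    show ?thesis
    proof (rule norm_infsum_le[OF diff majorant])
      fix Q
      show "norm (mcoeff (T j) Q * mpower z Q -
          (if mdeg Q \<le> d then mcoeff (T j) Q * mpower z Q else 0))
        \<le> norm (mcoeff (T j) Q) * \<rho> ^ mdeg Q * (norm z / \<rho>) ^ Suc d"
      proof (cases "mdeg Q \<le> d")
        case False
        have "norm (mpower z Q) \<le> norm z ^ mdeg Q" by (rule norm_mpower_le)
        also have "\<dots> = \<rho> ^ mdeg Q * (norm z / \<rho>) ^ mdeg Q"
          using \<rho> by (simp add: power_divide)
        also have "\<dots> \<le> \<rho> ^ mdeg Q * (norm z / \<rho>) ^ Suc d"
          using \<rho> z False by (intro mult_left_mono power_decreasing) auto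
        finally have "norm (mcoeff (T j) Q) * norm (mpower z Q) \<le>
            norm (mcoeff (T j) Q) * (\<rho> ^ mdeg Q * (norm z / \<rho>) ^ Suc d)"
          by (rule mult_left_mono) simp
        then show ?thesis
          by (simp only: False if_False diff_zero norm_mult mult.assoc)
      qed (use \<rho> in simp)
    qed
  qed
  have "eventually (\<lambda>z :: 'n cvec. dist z 0 < \<rho>) (nhds 0)"
    by (rule eventually_nhds_metric[THEN iffD2]) (use \<rho> in auto)
  then have "eventually (\<lambda>z. norm (F z $ j - jet_poly d (T j) z) \<le>
      C / \<rho> ^ Suc d * norm (complex_of_real (norm z ^ Suc d))) (nhds 0)"
    by eventually_elim (use bound in \<open>auto simp: power_divide norm_power norm_mult\<close>)
  then show ?thesis
    unfolding has_jet_def vanishing_order_def by (rule bigoI)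
qed

section \<open>Order and closeness of formal series\<close>

text \<open>
  Both series have order at least \<open>a\<close>, and they agree in the \<open>d\<close> degrees from \<open>a\<close> on. Counting the
  agreement from the order, not from degree 0, makes the relation multiplicative: orders
  add up while \<open>d\<close> stays. A product of two or more series of order 1 therefore agrees in more
  degrees than its factors do, which is the contraction behind the formal inverse.
\<close>

definition mfps_close :: "nat \<Rightarrow> nat \<Rightarrow> ('n::finite, complex) mfps \<Rightarrow> ('n, complex) mfps \<Rightarrow> bool"
  where "mfps_close a d f g \<longleftrightarrow>
    (\<forall>Q. mdeg Q < a \<longrightarrow> mcoeff f Q = 0 \<and> mcoeff g Q = 0) \<and>
    (\<forall>Q. mdeg Q < a + d \<longrightarrow> mcoeff f Q = mcoeff g Q)"

lemma mfps_close_one: "mfps_close 0 d 1 1"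
  by (simp add: mfps_close_def)

lemma mfps_close_mult:
  assumes "mfps_close a d f f'" and "mfps_close b d g g'"
  shows "mfps_close (a + b) d (f * g) (f' * g')"
proof -
  have low: "mcoeff f A * mcoeff g B = 0 \<and> mcoeff f' A * mcoeff g' B = 0"
    if "mdeg A < a \<or> mdeg B < b" for A B
    using assms that by (auto simp: mfps_close_def)
  have eq: "mcoeff f A * mcoeff g B = mcoeff f' A * mcoeff g' B"
    if "mdeg (A + B) < a + b + d" for A B
  proof (cases "mdeg A < a \<or> mdeg B < b")
    case False
    then have "mdeg A < a + d" "mdeg B < b + d" using that by (auto simp: mdeg_add)
    with assms show ?thesis by (auto simp: mfps_close_def)
  qed (metis low)
  show ?thesis
    unfolding mfps_close_def times_mfps_def mcoeff_Abs
  proof (intro conjI allI impI)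
    fix Q :: "'a \<Rightarrow> nat" assume Q: "mdeg Q < a + b"
    have "mdeg A < a \<or> mdeg B < b" if "A + B = Q" for A B
      using Q that by (auto simp: mdeg_add)
    with low show "(\<Sum>(A, B)\<in>{(A, B). A + B = Q}. mcoeff f A * mcoeff g B) = 0"
        and "(\<Sum>(A, B)\<in>{(A, B). A + B = Q}. mcoeff f' A * mcoeff g' B) = 0"
      by (fastforce intro!: sum.neutral)+
  next
    fix Q :: "'a \<Rightarrow> nat" assume "mdeg Q < a + b + d"
    with eq show "(\<Sum>(A, B)\<in>{(A, B). A + B = Q}. mcoeff f A * mcoeff g B) =
        (\<Sum>(A, B)\<in>{(A, B). A + B = Q}. mcoeff f' A * mcoeff g' B)"
      by (intro sum.cong) auto
  qed
qed

lemma mfps_close_monomial: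
  assumes "\<And>h. mfps_close 1 d (G h) (G' h)"
  shows "mfps_close (mdeg A) d (\<Prod>h\<in>UNIV. G h ^ A h) (\<Prod>h\<in>UNIV. G' h ^ A h)"
proof -
  have pow: "mfps_close k d (G h ^ k) (G' h ^ k)" for h k
    by (induction k) (use mfps_close_one mfps_close_mult[OF assms] in auto)
  have "mfps_close (\<Sum>h\<in>I. A h) d (\<Prod>h\<in>I. G h ^ A h) (\<Prod>h\<in>I. G' h ^ A h)" for I
    by (induction I rule: infinite_finite_induct)
      (auto simp: mfps_close_one intro: mfps_close_mult pow)
  then show ?thesis by (simp add: mdeg_def)
qed

lemma mcoeff_monomial_below:
  fixes G :: "'n::finite formal_map"
  assumes "\<And>h. mcoeff (G h) 0 = 0" and "mdeg Q < mdeg A"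
  shows "mcoeff (\<Prod>h\<in>UNIV. G h ^ A h) Q = 0"
proof -
  have "mfps_close 1 0 (G h) (G h)" for h
    using assms(1) by (auto simp: mfps_close_def mdeg_eq_0_iff)
  then have "mfps_close (mdeg A) 0 (\<Prod>h\<in>UNIV. G h ^ A h) (\<Prod>h\<in>UNIV. G h ^ A h)"
    by (rule mfps_close_monomial)
  with assms(2) show ?thesis by (simp add: mfps_close_def)
qed

section \<open>Composition of expansions and of formal maps\<close>

lemma bigo_norm_if_components:
  fixes g :: "'n::finite cvec \<Rightarrow> 'm::finite cvec"
  assumes "\<And>j. (\<lambda>z. g z $ j) \<in> vanishing_order 1"
  shows "(\<lambda>z. complex_of_real (norm (g z))) \<in> vanishing_order 1"
proof -
  have "(\<lambda>z. \<Sum>j\<in>UNIV. complex_of_real (norm (g z $ j))) \<in> vanishing_order 1"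
  proof (rule vanishing_order_sum)
    fix j
    have "(\<lambda>z. complex_of_real (norm (g z $ j))) \<in> O[nhds 0](\<lambda>z. g z $ j)"
      by (rule bigoI[of _ 1]) simp
    with assms[of j] show "(\<lambda>z. complex_of_real (norm (g z $ j))) \<in> vanishing_order 1"
      unfolding vanishing_order_def using landau_o.big_trans by blast
  qed
  moreover have "(\<lambda>z. complex_of_real (norm (g z))) \<in>
      O[nhds 0](\<lambda>z. \<Sum>j\<in>UNIV. complex_of_real (norm (g z $ j)))"
  proof (rule bigoI[of _ 1], rule always_eventually, rule allI)
    fix z
    have "norm (g z) \<le> (\<Sum>j\<in>UNIV. norm (g z $ j))"
      unfolding norm_vec_def by (rule L2_set_le_sum) simp
    then show "norm (complex_of_real (norm (g z))) \<le>
        1 * norm (\<Sum>j\<in>UNIV. complex_of_real (norm (g z $ j)))"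
      by (simp flip: of_real_sum add: sum_nonneg)
  qed
  ultimately show ?thesis
    unfolding vanishing_order_def using landau_o.big_trans by blast
qed

lemma filterlim_if_vanishing_order_1:
  fixes g :: "'n::finite cvec \<Rightarrow> 'm::finite cvec"
  assumes "(\<lambda>z. complex_of_real (norm (g z))) \<in> vanishing_order 1"
  shows "filterlim g (nhds 0) (nhds 0)"
proof -
  from assms obtain C where "eventually (\<lambda>z. norm (g z) \<le> C * norm z) (nhds 0)"
    unfolding vanishing_order_def by (auto elim: landau_o.bigE)
  moreover have "((\<lambda>z :: 'n cvec. C * norm z) \<longlongrightarrow> C * norm (0 :: 'n cvec)) (nhds 0)"
    by (intro tendsto_intros filterlim_ident)
  ultimately have "((\<lambda>z. norm (g z)) \<longlongrightarrow> 0) (nhds 0)"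
    by - (rule tendsto_sandwich[where f = "\<lambda>_. 0" and h = "\<lambda>z. C * norm z"], simp_all)
  then show ?thesis by (rule tendsto_norm_zero_cancel)
qed

lemma vanishing_order_compose:
  fixes g :: "'n::finite cvec \<Rightarrow> 'm::finite cvec"
  assumes "f \<in> vanishing_order a" and "\<And>j. (\<lambda>z. g z $ j) \<in> vanishing_order 1"
  shows "(\<lambda>z. f (g z)) \<in> vanishing_order a"
proof -
  have g: "(\<lambda>z. complex_of_real (norm (g z))) \<in> vanishing_order 1"
    using assms(2) by (rule bigo_norm_if_components)
  have "(\<lambda>z. f (g z)) \<in> O[nhds 0](\<lambda>z. complex_of_real (norm (g z) ^ a))"
    using assms(1)[unfolded vanishing_order_def] filterlim_if_vanishing_order_1[OF g]
    by (rule landau_o.big.compose)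
  moreover have "(\<lambda>z. complex_of_real (norm (g z) ^ a)) \<in> vanishing_order a"
    using landau_o.big_power[OF g[unfolded vanishing_order_def], of a]
    by (simp add: vanishing_order_def)
  ultimately show ?thesis
    unfolding vanishing_order_def using landau_o.big_trans by blast
qed

text \<open>
  Replacing \<open>f\<close> by its truncation costs \<open>O(\<parallel>g z\<parallel>\<^bsup>d+1\<^esup>)\<close>, hence \<open>O(\<parallel>z\<parallel>\<^bsup>d+1\<^esup>)\<close>; what remains is a linear
  combination of products of the components of \<open>g\<close>, whose expansions are known.
\<close>

lemma has_jet_compose:
  fixes g :: "'m::finite cvec \<Rightarrow> 'm cvec"
  assumes f: "has_jet d f T" and g: "\<And>j. has_jet d (\<lambda>z. g z $ j) (S j)"
    and S: "\<And>j. mcoeff (S j) 0 = 0"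
  shows "has_jet d (\<lambda>z. f (g z)) (mfps_compose T S)"
proof -
  have "(\<lambda>z. g z $ j) \<in> vanishing_order 1" for j
    using g[of j] by (rule has_jet_vanishing_order) (use S in \<open>auto simp: mdeg_eq_0_iff\<close>)
  with f have outer: "(\<lambda>z. f (g z) - jet_poly d T (g z)) \<in> vanishing_order (Suc d)"
    unfolding has_jet_def by (rule vanishing_order_compose)
  define M where "M A = (\<Prod>h\<in>UNIV. S h ^ A h)" for A
  have M: "has_jet d (\<lambda>z. mpower (g z) A) (M A)" for A
    unfolding M_def mpower_def by (intro has_jet_prod has_jet_power g) auto
  have "jet_poly d (mfps_compose T S) z =
      (\<Sum>A | mdeg A \<le> d. mcoeff T A * jet_poly d (M A) z)" for z
  proof -
    have "jet_poly d (mfps_compose T S) z =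
        (\<Sum>Q | mdeg Q \<le> d. (\<Sum>A | mdeg A \<le> mdeg Q. mcoeff T A * mcoeff (M A) Q) * mpower z Q)"
      by (simp add: jet_poly_def mfps_compose_def M_def)
    \<comment> \<open>the terms with \<open>mdeg Q < mdeg A\<close> vanish, so that the inner range can be made independent of \<open>Q\<close>\<close>
    also have "\<dots> =
        (\<Sum>Q | mdeg Q \<le> d. (\<Sum>A | mdeg A \<le> d. mcoeff T A * mcoeff (M A) Q) * mpower z Q)"
    proof (rule sum.cong[OF refl])
      fix Q :: "'m \<Rightarrow> nat" assume Q: "Q \<in> {Q. mdeg Q \<le> d}"
      have "(\<Sum>A | mdeg A \<le> mdeg Q. mcoeff T A * mcoeff (M A) Q) =
          (\<Sum>A | mdeg A \<le> d. mcoeff T A * mcoeff (M A) Q)"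
        using Q mcoeff_monomial_below[OF S, of Q]
        by (intro sum.mono_neutral_left) (auto simp: finite_mdeg_le M_def)
      then show "(\<Sum>A | mdeg A \<le> mdeg Q. mcoeff T A * mcoeff (M A) Q) * mpower z Q =
          (\<Sum>A | mdeg A \<le> d. mcoeff T A * mcoeff (M A) Q) * mpower z Q" by simp
    qed
    also have "\<dots> = (\<Sum>A | mdeg A \<le> d. mcoeff T A * jet_poly d (M A) z)"
      unfolding jet_poly_def sum_distrib_left sum_distrib_right
      by (subst sum.swap) (simp add: mult.assoc)
    finally show ?thesis .
  qed
  then have "(\<lambda>z. jet_poly d T (g z) - jet_poly d (mfps_compose T S) z) =
      (\<lambda>z. \<Sum>A | mdeg A \<le> d. mcoeff T A * (mpower (g z) A - jet_poly d (M A) z))"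
    by (simp add: jet_poly_def[of d T] sum_subtractf right_diff_distrib)
  also have "\<dots> \<in> vanishing_order (Suc d)"
    by (intro vanishing_order_sum vanishing_order_cmult) (use M in \<open>simp add: has_jet_def\<close>)
  finally have "(\<lambda>z. (f (g z) - jet_poly d T (g z)) +
      (jet_poly d T (g z) - jet_poly d (mfps_compose T S) z)) \<in> vanishing_order (Suc d)"
    by (intro vanishing_order_add outer)
  then show ?thesis by (simp add: has_jet_def)
qed

definition fixes_origin :: "'n::finite formal_map \<Rightarrow> bool"
  where "fixes_origin \<Phi> \<longleftrightarrow> (\<forall>j. mcoeff (\<Phi> j) 0 = 0)"

definition formal_id :: "'n::finite formal_map"
  where "formal_id j = Abs_mfps (\<lambda>Q. if Q = munit j then 1 else 0)"

lemma munit_neq_0 [simp]: "munit (j :: 'n::finite) \<noteq> 0" "0 \<noteq> munit j"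
  using mdeg_munit[of j] by (auto simp del: mdeg_munit)

lemma fixes_origin_formal_id: "fixes_origin formal_id"
  by (simp add: fixes_origin_def formal_id_def)

lemma fixes_origin_compose:
  "fixes_origin \<Phi> \<Longrightarrow> fixes_origin (formal_compose \<Phi> \<Psi>)"
  by (simp add: fixes_origin_def formal_compose_def mfps_compose_def mdeg_eq_0_iff)

lemma has_jet_formal_id: "has_jet d (\<lambda>z. z $ j) (formal_id j)"
proof (cases "d = 0")
  case True
  have "(\<lambda>z :: 'a cvec. z $ j) \<in> vanishing_order 1"
    using mpower_vanishing_order[of "munit j"] by simp
  with True show ?thesis
    by (simp add: has_jet_def jet_poly_def formal_id_def mdeg_eq_0_iff)
next
  case False
  have "jet_poly d (formal_id j) z = (\<Sum>Q\<in>{munit j}. mpower z Q)" for z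
    unfolding jet_poly_def
    by (rule sum.mono_neutral_cong_right)
      (use False in \<open>auto simp: formal_id_def finite_mdeg_le split: if_splits\<close>)
  then show ?thesis by (simp add: has_jet_def)
qed

definition formal_map_jet :: "nat \<Rightarrow> 'n::finite formal_map \<Rightarrow> 'n cvec \<Rightarrow> 'n cvec"
  where "formal_map_jet d \<Phi> z = (\<chi> j. jet_poly d (\<Phi> j) z)"

lemma has_jet_formal_map_jet: "has_jet d (\<lambda>z. formal_map_jet d \<Phi> z $ j) (\<Phi> j)"
  by (simp add: formal_map_jet_def has_jet_jet_poly)

text \<open>
  Composition of the polynomial maps obtained by truncation is associative because composition of
  functions is, and both formal compositions expand the same composite function.
\<close>

lemma formal_compose_assoc:
  assumes "fixes_origin \<Psi>" and "fixes_origin \<Omega>"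
  shows "formal_compose (formal_compose \<Phi> \<Psi>) \<Omega> = formal_compose \<Phi> (formal_compose \<Psi> \<Omega>)"
proof
  fix j
  show "formal_compose (formal_compose \<Phi> \<Psi>) \<Omega> j = formal_compose \<Phi> (formal_compose \<Psi> \<Omega>) j"
  proof (rule mfps_eq_if_jets)
    fix d
    have "has_jet d (\<lambda>z. jet_poly d (\<Phi> j) (formal_map_jet d \<Psi> (formal_map_jet d \<Omega> z)))
        (mfps_compose (mfps_compose (\<Phi> j) \<Psi>) \<Omega>)"
      using assms unfolding fixes_origin_def
      by (intro has_jet_compose[where f = "\<lambda>z. jet_poly d (\<Phi> j) (formal_map_jet d \<Psi> z)"]
            has_jet_compose[where g = "formal_map_jet d \<Psi>"] has_jet_jet_poly
            has_jet_formal_map_jet) auto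
    moreover have "has_jet d (\<lambda>z. jet_poly d (\<Phi> j) (formal_map_jet d \<Psi> (formal_map_jet d \<Omega> z)))
        (mfps_compose (\<Phi> j) (\<lambda>i. mfps_compose (\<Psi> i) \<Omega>))"
      using assms fixes_origin_compose[OF assms(1), of \<Omega>]
      unfolding fixes_origin_def formal_compose_def
      by (intro has_jet_compose[where g = "\<lambda>z. formal_map_jet d \<Psi> (formal_map_jet d \<Omega> z)"]
            has_jet_compose[where f = "\<lambda>z. formal_map_jet d \<Psi> z $ _"] has_jet_jet_poly
            has_jet_formal_map_jet) auto
    ultimately show "\<exists>f. has_jet d f (formal_compose (formal_compose \<Phi> \<Psi>) \<Omega> j) \<and>
        has_jet d f (formal_compose \<Phi> (formal_compose \<Psi> \<Omega>) j)"
      unfolding formal_compose_def by blast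
  qed
qed

lemma formal_compose_id_left:
  assumes "fixes_origin \<Phi>"
  shows "formal_compose formal_id \<Phi> = \<Phi>"
proof
  fix j
  show "formal_compose formal_id \<Phi> j = \<Phi> j"
  proof (rule mfps_eq_if_jets)
    fix d
    have "has_jet d (\<lambda>z. formal_map_jet d \<Phi> z $ j) (mfps_compose (formal_id j) \<Phi>)"
      using assms unfolding fixes_origin_def
      by (intro has_jet_compose[where f = "\<lambda>z. z $ j"] has_jet_formal_id has_jet_formal_map_jet)
         auto
    then show "\<exists>f. has_jet d f (formal_compose formal_id \<Phi> j) \<and> has_jet d f (\<Phi> j)"
      using has_jet_formal_map_jet unfolding formal_compose_def by blast
  qed
qed

lemma formal_compose_id_right: "formal_compose \<Phi> formal_id = \<Phi>"
proof
  fix j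
  show "formal_compose \<Phi> formal_id j = \<Phi> j"
  proof (rule mfps_eq_if_jets)
    fix d
    have "has_jet d (\<lambda>z. jet_poly d (\<Phi> j) z) (mfps_compose (\<Phi> j) formal_id)"
      using fixes_origin_formal_id unfolding fixes_origin_def
      by (intro has_jet_compose[where g = "\<lambda>z. z"] has_jet_formal_id has_jet_jet_poly) auto
    then show "\<exists>f. has_jet d f (formal_compose \<Phi> formal_id j) \<and> has_jet d f (\<Phi> j)"
      using has_jet_jet_poly unfolding formal_compose_def by blast
  qed
qed

text \<open>
  The expansion of order 0 is exact at the origin itself.
\<close>

lemma taylor_series_fixes_origin:
  assumes "has_taylor_series F T" and "F 0 = 0"
  shows "fixes_origin T"
  unfolding fixes_origin_def
proof
  fix j
  have "(\<lambda>z. F z $ j - jet_poly 0 (T j) z) \<in> vanishing_order 1"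
    using has_taylor_series_imp_has_jet[OF assms(1), of 0 j] by (simp add: has_jet_def)
  then obtain C where "\<forall>\<^sub>F z in nhds 0. norm (F z $ j - jet_poly 0 (T j) z) \<le> C * norm z"
    unfolding vanishing_order_def by (auto elim: landau_o.bigE)
  from eventually_nhds_x_imp_x[OF this] assms(2) show "mcoeff (T j) 0 = 0"
    by (simp add: jet_poly_def mdeg_eq_0_iff)
qed

lemma taylor_series_of_inverse:
  assumes T: "has_taylor_series F T" and S: "has_taylor_series G S"
    and "G 0 = 0" and "\<forall>\<^sub>F z in nhds 0. F (G z) = z"
  shows "formal_compose T S = formal_id"
proof
  fix j
  show "formal_compose T S j = formal_id j"
  proof (rule mfps_eq_if_jets)
    fix d
    have "has_jet d (\<lambda>z. F (G z) $ j) (mfps_compose (T j) S)"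
      using taylor_series_fixes_origin[OF S \<open>G 0 = 0\<close>] unfolding fixes_origin_def
      by (intro has_jet_compose[where f = "\<lambda>z. F z $ j"] has_taylor_series_imp_has_jet S T) auto
    moreover have "\<forall>\<^sub>F z in nhds 0. F (G z) $ j = z $ j"
      using assms(4) by eventually_elim simp
    ultimately have "has_jet d (\<lambda>z. z $ j) (mfps_compose (T j) S)"
      by (rule has_jet_eventually_cong[rotated])
    with has_jet_formal_id[of d j]
    show "\<exists>f. has_jet d f (formal_compose T S j) \<and> has_jet d f (formal_id j)"
      unfolding formal_compose_def by blast
  qed
qed

section \<open>The formal inverse\<close>

lemma monomial_munit:
  fixes M :: "'n::finite \<Rightarrow> 'a::comm_semiring_1"
  shows "(\<Prod>h\<in>UNIV. M h ^ munit s h) = M s"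
proof -
  have "(\<Prod>h\<in>UNIV. M h ^ munit s h) = (\<Prod>h\<in>UNIV. if h = s then M h else 1)"
    unfolding munit_def by (rule prod.cong) auto
  then show ?thesis by simp
qed

text \<open>
  One step of solving \<open>N \<circ> M = id\<close> for \<open>M\<close>: with \<open>N\<^sub>s = \<lambda>\<^sub>s z\<^sub>s + R\<^sub>s\<close>, where \<open>R\<^sub>s\<close> has order at least 2, the
  equation reads \<open>M\<^sub>s = \<lambda>\<^sub>s\<inverse> (z\<^sub>s - R\<^sub>s(M))\<close>.
\<close>

definition inverse_step :: "'n::finite cvec \<Rightarrow> 'n formal_map \<Rightarrow> 'n formal_map \<Rightarrow> 'n formal_map"
  where "inverse_step lam N M s = Abs_mfps (\<lambda>Q. inverse (lam $ s) *
    ((if Q = munit s then 1 else 0) -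
     (\<Sum>A | 2 \<le> mdeg A \<and> mdeg A \<le> mdeg Q. mcoeff (N s) A * mcoeff (\<Prod>h\<in>UNIV. M h ^ A h) Q)))"

primrec inverse_iterate :: "'n::finite cvec \<Rightarrow> 'n formal_map \<Rightarrow> nat \<Rightarrow> 'n formal_map"
  where "inverse_iterate lam N 0 = (\<lambda>s. 0)"
  | "inverse_iterate lam N (Suc k) = inverse_step lam N (inverse_iterate lam N k)"

text \<open>
  The \<open>k\<close>-th iterate is final up to degree \<open>k\<close>, so that the coefficient at \<open>Q\<close> may be read off from
  iterate number \<open>mdeg Q\<close>. Reaching the inverse through iterates gives properties of its
  coefficients by plain induction on \<open>k\<close>.
\<close>

definition formal_inverse :: "'n::finite cvec \<Rightarrow> 'n formal_map \<Rightarrow> 'n formal_map"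
  where "formal_inverse lam N s = Abs_mfps (\<lambda>Q. mcoeff (inverse_iterate lam N (mdeg Q) s) Q)"

lemma mcoeff_inverse_step_low:
  "mdeg Q \<le> 1 \<Longrightarrow> mcoeff (inverse_step lam N M s) Q = (if Q = munit s then inverse (lam $ s) else 0)"
proof -
  assume "mdeg Q \<le> 1"
  then have "{A :: 'a \<Rightarrow> nat. 2 \<le> mdeg A \<and> mdeg A \<le> mdeg Q} = {}" by auto
  then show ?thesis by (simp only: inverse_step_def mcoeff_Abs sum.empty) simp
qed

text \<open>
  Only monomials of degree at least 2 in \<open>M\<close> enter a step, and such monomials gain a degree of
  agreement.
\<close>

lemma inverse_step_close:
  assumes "\<And>h. mfps_close 1 d (M h) (M' h)"
  shows "mfps_close 1 (Suc d) (inverse_step lam N M s) (inverse_step lam N M' s)"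
  unfolding mfps_close_def
proof (intro conjI allI impI)
  fix Q :: "'a \<Rightarrow> nat" assume Q: "mdeg Q < 1 + Suc d"
  have "mcoeff (\<Prod>h\<in>UNIV. M h ^ A h) Q = mcoeff (\<Prod>h\<in>UNIV. M' h ^ A h) Q" if "2 \<le> mdeg A" for A
    using mfps_close_monomial[OF assms, of A "\<lambda>h. h"] Q that by (simp add: mfps_close_def)
  then have "(\<Sum>A | 2 \<le> mdeg A \<and> mdeg A \<le> mdeg Q.
        mcoeff (N s) A * mcoeff (\<Prod>h\<in>UNIV. M h ^ A h) Q) =
      (\<Sum>A | 2 \<le> mdeg A \<and> mdeg A \<le> mdeg Q.
        mcoeff (N s) A * mcoeff (\<Prod>h\<in>UNIV. M' h ^ A h) Q)"
    by (intro sum.cong) auto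
  then show "mcoeff (inverse_step lam N M s) Q = mcoeff (inverse_step lam N M' s) Q"
    by (simp add: inverse_step_def)
qed (auto simp: mcoeff_inverse_step_low mdeg_eq_0_iff)

lemma inverse_iterate_0: "mcoeff (inverse_iterate lam N k s) 0 = 0"
  by (cases k) (simp_all add: zero_mfps_def mcoeff_inverse_step_low)

lemma inverse_iterate_close:
  "mfps_close 1 d (inverse_iterate lam N d s) (inverse_iterate lam N (d + k) s)"
proof (induction d arbitrary: s)
  case 0
  show ?case by (auto simp: mfps_close_def mdeg_eq_0_iff inverse_iterate_0 zero_mfps_def)
next
  case (Suc d)
  show ?case
    unfolding add_Suc inverse_iterate.simps by (rule inverse_step_close[OF Suc.IH])
qed

lemma formal_inverse_close:
  "mfps_close 1 d (inverse_iterate lam N d s) (formal_inverse lam N s)"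
  unfolding mfps_close_def
proof (intro conjI allI impI)
  fix Q :: "'a \<Rightarrow> nat" assume Q: "mdeg Q < 1 + d"
  then obtain k where k: "d = mdeg Q + k" using le_Suc_ex less_Suc_eq_le by (metis plus_1_eq_Suc)
  show "mcoeff (inverse_iterate lam N d s) Q = mcoeff (formal_inverse lam N s) Q"
    using inverse_iterate_close[of "mdeg Q" lam N s k]
    by (simp add: formal_inverse_def k mfps_close_def)
qed (auto simp: mdeg_eq_0_iff inverse_iterate_0 formal_inverse_def zero_mfps_def)

lemma formal_inverse_fixpoint: "inverse_step lam N (formal_inverse lam N) = formal_inverse lam N"
proof (intro ext mfps_eqI)
  fix s :: 'a and Q :: "'a \<Rightarrow> nat"
  have "mfps_close 1 (Suc (mdeg Q)) (inverse_iterate lam N (Suc (mdeg Q)) s)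
      (inverse_step lam N (formal_inverse lam N) s)"
    using inverse_step_close[OF formal_inverse_close] by simp
  moreover have "mfps_close 1 (Suc (mdeg Q)) (inverse_iterate lam N (Suc (mdeg Q)) s)
      (formal_inverse lam N s)"
    by (rule formal_inverse_close)
  ultimately show "mcoeff (inverse_step lam N (formal_inverse lam N) s) Q =
      mcoeff (formal_inverse lam N s) Q"
    by (simp add: mfps_close_def)
qed

lemma mcoeff_formal_inverse:
  "mcoeff (formal_inverse lam N s) Q = inverse (lam $ s) * ((if Q = munit s then 1 else 0) -
     (\<Sum>A | 2 \<le> mdeg A \<and> mdeg A \<le> mdeg Q.
        mcoeff (N s) A * mcoeff (\<Prod>h\<in>UNIV. formal_inverse lam N h ^ A h) Q))"
  by (subst formal_inverse_fixpoint[symmetric]) (simp add: inverse_step_def)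

lemma has_diagonal_part_formal_inverse:
  "has_diagonal_part (inverse_eigenvalues lam) (formal_inverse lam N)"
  unfolding has_diagonal_part_def
  by (subst formal_inverse_fixpoint[symmetric])
    (simp add: mcoeff_inverse_step_low inverse_eigenvalues_def)

lemma fixes_origin_if_diagonal_part: "has_diagonal_part lam \<Phi> \<Longrightarrow> fixes_origin \<Phi>"
  by (simp add: has_diagonal_part_def fixes_origin_def)

text \<open>
  In the composition the constant and linear part of \<open>N\<close> contributes \<open>\<lambda>\<^sub>s M\<^sub>s\<close> alone, and the
  fixed point equation says that this cancels everything else up to \<open>z\<^sub>s\<close>.
\<close>

lemma formal_compose_inverse:
  assumes "has_diagonal_part lam N" and "\<And>j. lam $ j \<noteq> 0"
  shows "formal_compose N (formal_inverse lam N) = formal_id"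
proof (intro ext mfps_eqI)
  fix s Q
  define M where "M = formal_inverse lam N"
  define tm where "tm A = mcoeff (N s) A * mcoeff (\<Prod>h\<in>UNIV. M h ^ A h) Q" for A
  have N: "mcoeff (N s) A = (if A = munit s then lam $ s else 0)" if "mdeg A \<le> 1" for A
    using assms(1) that by (simp add: has_diagonal_part_def)
  have comp: "mcoeff (formal_compose N M s) Q = (\<Sum>A | mdeg A \<le> mdeg Q. tm A)"
    by (simp add: formal_compose_def mfps_compose_def tm_def)
  show "mcoeff (formal_compose N (formal_inverse lam N) s) Q = mcoeff (formal_id s) Q"
  proof (cases "Q = 0")
    case True
    then show ?thesis
      using comp N[of 0] by (simp add: M_def[symmetric] mdeg_eq_0_iff tm_def formal_id_def)
  next
    case False
    then have "mdeg Q \<noteq> 0" by (simp add: mdeg_eq_0_iff)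
    have fin: "finite {A :: 'a \<Rightarrow> nat. 2 \<le> mdeg A \<and> mdeg A \<le> mdeg Q}"
      by (rule finite_subset[OF _ finite_mdeg_le[of "mdeg Q"]]) auto
    have "(\<Sum>A | mdeg A \<le> mdeg Q. tm A) =
        sum tm (insert (munit s) {A. 2 \<le> mdeg A \<and> mdeg A \<le> mdeg Q})"
    proof (rule sum.mono_neutral_right)
      show "\<forall>A\<in>{A. mdeg A \<le> mdeg Q} - insert (munit s) {A. 2 \<le> mdeg A \<and> mdeg A \<le> mdeg Q}. tm A = 0"
        by (auto simp: tm_def) (metis N One_nat_def not_less_eq_eq numeral_2_eq_2)
    qed (use \<open>mdeg Q \<noteq> 0\<close> in \<open>auto simp: finite_mdeg_le\<close>)
    also have "\<dots> = tm (munit s) + (\<Sum>A | 2 \<le> mdeg A \<and> mdeg A \<le> mdeg Q. tm A)"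
      using fin by (intro sum.insert) auto
    also have "tm (munit s) = lam $ s * mcoeff (M s) Q"
      by (simp add: tm_def N monomial_munit)
    also have "\<dots> = (if Q = munit s then 1 else 0) - (\<Sum>A | 2 \<le> mdeg A \<and> mdeg A \<le> mdeg Q. tm A)"
      unfolding M_def tm_def by (subst mcoeff_formal_inverse) (simp add: assms(2))
    finally show ?thesis by (simp add: comp M_def[symmetric] formal_id_def)
  qed
qed

section \<open>Resonant series\<close>

lemma mcomb_zero [simp]: "mcomb P 0 = 0"
  by (simp add: mcomb_def fun_eq_iff)

lemma mcomb_add: "mcomb P (K + K') = mcomb P K + mcomb P K'"
  by (simp add: mcomb_def fun_eq_iff add_mult_distrib sum.distrib)

text \<open>
  This is where the linear independence of the generators over the rationals enters. It makes the
  weight \<open>|K|\<close> of a resonant monomial well defined.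
\<close>

lemma mcomb_cancel:
  fixes P :: "'m::finite \<Rightarrow> 'n::{finite,linorder} \<Rightarrow> nat"
  assumes gens: "resonance_generators r lam P" and eq: "mcomb P K = mcomb P K'"
  shows "K = K'"
proof
  fix t
  define p :: "'m \<Rightarrow> (rat, 'n) vec" where "p t = (\<chi> h. rat_of_nat (P t h))" for t
  have "inj P" and indep: "vec.independent (range p)"
    using gens by (auto simp: resonance_generators_def p_def)
  then have inj: "inj p"
    unfolding inj_def p_def by (auto simp: vec_eq_iff fun_eq_iff)
  define c where "c v = rat_of_nat (K (inv p v)) - rat_of_nat (K' (inv p v))" for v
  have "(\<Sum>v\<in>range p. c v *s v) = (\<Sum>t\<in>UNIV. (rat_of_nat (K t) - rat_of_nat (K' t)) *s p t)"
    using inj by (simp add: sum.reindex c_def)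
  also have "\<dots> = 0"
  proof (rule vec_eq_iff[THEN iffD2], rule allI)
    fix h
    have "rat_of_nat (mcomb P K h) = rat_of_nat (mcomb P K' h)" by (simp add: eq)
    then show "(\<Sum>t\<in>UNIV. (rat_of_nat (K t) - rat_of_nat (K' t)) *s p t) $ h = 0 $ h"
      by (simp add: p_def mcomb_def left_diff_distrib sum_subtractf)
  qed
  finally have "c (p t) = 0"
    by (intro vec.independentD[OF indep, of "range p"]) auto
  then show "K t = K' t" using inj by (simp add: c_def)
qed

text \<open>
  \<open>f\<close> is \<open>z\<^sup>A\<close> times a series in the monomials \<open>z\<^bsup>KP\<^esup>\<close>, with constant term \<open>c\<close> of that series.
\<close>

definition has_leading_term ::
    "('m::finite \<Rightarrow> 'n \<Rightarrow> nat) \<Rightarrow> ('n::finite \<Rightarrow> nat) \<Rightarrow> complex \<Rightarrow> ('n, complex) mfps \<Rightarrow> bool"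
  where "has_leading_term P A c f \<longleftrightarrow>
    (\<forall>Q. mcoeff f Q \<noteq> 0 \<longrightarrow> (\<exists>K. Q = A + mcomb P K)) \<and> mcoeff f A = c"

lemma has_leading_term_one: "has_leading_term P 0 1 1"
proof -
  have "\<exists>K. mcomb P K = 0" by (rule exI[of _ 0]) simp
  then show ?thesis by (auto simp: has_leading_term_def one_mfps_def)
qed

text \<open>
  Since the generators have nonnegative entries, \<open>KP + K'P = 0\<close> only if \<open>KP = K'P = 0\<close>; so the leading
  coefficient of the product involves no other coefficients of the factors.
\<close>

lemma has_leading_term_mult:
  assumes f: "has_leading_term P A a f" and g: "has_leading_term P B b g"
  shows "has_leading_term P (A + B) (a * b) (f * g)"
  unfolding has_leading_term_def
proof (intro conjI allI impI)
  fix Q assume "mcoeff (f * g) Q \<noteq> 0"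
  then obtain A' B' where Q [symmetric]: "A' + B' = Q" and nz: "mcoeff f A' * mcoeff g B' \<noteq> 0"
    unfolding times_mfps_def mcoeff_Abs by (auto elim!: sum.not_neutral_contains_not_neutral)
  with f g obtain K K' where "A' = A + mcomb P K" "B' = B + mcomb P K'"
    unfolding has_leading_term_def by (metis mult_eq_0_iff)
  with Q have "Q = A + B + mcomb P (K + K')"
    using \<open>A' = _\<close> \<open>B' = _\<close> by (simp add: mcomb_add ac_simps)
  then show "\<exists>K. Q = A + B + mcomb P K" by blast
next
  have leading: "mcoeff f A = a" "mcoeff g B = b"
    using f g unfolding has_leading_term_def by blast+
  have other: "mcoeff f A' * mcoeff g B' = 0" if "A' + B' = A + B" "(A', B') \<noteq> (A, B)" for A' B'
  proof (rule ccontr)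
    assume "mcoeff f A' * mcoeff g B' \<noteq> 0"
    with f g obtain K K' where AB: "A' = A + mcomb P K" "B' = B + mcomb P K'"
      unfolding has_leading_term_def by (metis mult_eq_0_iff)
    with that(1) have "mcomb P K = 0" "mcomb P K' = 0" by (auto simp: fun_eq_iff)
    with AB that(2) show False by simp
  qed
  have "(\<Sum>(A', B')\<in>{(A', B'). A' + B' = A + B}. mcoeff f A' * mcoeff g B') =
      (\<Sum>(A', B')\<in>{(A, B)}. mcoeff f A' * mcoeff g B')"
  proof (rule sum.mono_neutral_right)
    show "\<forall>x\<in>{(A', B'). A' + B' = A + B} - {(A, B)}.
        (case x of (A', B') \<Rightarrow> mcoeff f A' * mcoeff g B') = 0"
    proof
      fix x assume x: "x \<in> {(A', B'). A' + B' = A + B} - {(A, B)}"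
      obtain A' B' where AB: "x = (A', B')" by (cases x)
      with x have "A' + B' = A + B" "(A', B') \<noteq> (A, B)" by auto
      from other[OF this] AB show "(case x of (A', B') \<Rightarrow> mcoeff f A' * mcoeff g B') = 0"
        by simp
    qed
  qed (auto simp: finite_antidiagonal)
  then show "mcoeff (f * g) (A + B) = a * b"
    using leading by (simp add: times_mfps_def)
qed

text \<open>
  Only the coordinates that occur in \<open>z\<^sup>A\<close> need to be resonant series. This matters because the
  last \<open>n - r\<close> components of a normal form are arbitrary.
\<close>

lemma has_leading_term_monomial:
  fixes G :: "'n::finite formal_map"
  assumes "\<And>h. A h \<noteq> 0 \<Longrightarrow> has_leading_term P (munit h) (c $ h) (G h)"
  shows "has_leading_term P A (mpower c A) (\<Prod>h\<in>UNIV. G h ^ A h)"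
proof -
  have pow: "has_leading_term P (\<lambda>i. k * munit h i) ((c $ h) ^ k) (G h ^ k)"
    if "k \<noteq> 0 \<longrightarrow> A h \<noteq> 0" for h k
    using that
  proof (induction k)
    case 0
    then show ?case using has_leading_term_one[of P] by (simp add: zero_fun_def)
  next
    case (Suc k)
    have "has_leading_term P (munit h + (\<lambda>i. k * munit h i)) (c $ h * (c $ h) ^ k) (G h * G h ^ k)"
      by (intro has_leading_term_mult Suc.IH assms) (use Suc.prems in auto)
    moreover have "munit h + (\<lambda>i. k * munit h i) = (\<lambda>i. Suc k * munit h i)"
      by (auto simp: fun_eq_iff)
    ultimately show ?case by simp
  qed
  have lead: "has_leading_term P (\<Sum>h\<in>I. (\<lambda>i. A h * munit h i)) (\<Prod>h\<in>I. (c $ h) ^ A h) (\<Prod>h\<in>I. G h ^ A h)"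
    if "finite I" for I
    using that
  proof (induction I)
    case empty
    show ?case using has_leading_term_one by (simp only: sum.empty prod.empty)
  next
    case (insert x I)
    show ?case
      unfolding sum.insert[OF insert.hyps] prod.insert[OF insert.hyps]
      by (intro has_leading_term_mult insert.IH pow) simp
  qed
  have sum_apply: "(\<Sum>h\<in>I. f h) i = (\<Sum>h\<in>I. f h i)"
    for I :: "'n set" and f :: "'n \<Rightarrow> 'n \<Rightarrow> nat" and i
    by (induction I rule: infinite_finite_induct) auto
  have exponents: "(\<Sum>h\<in>UNIV. (\<lambda>i. A h * munit h i)) = A"
  proof
    fix i
    have "(\<Sum>h\<in>UNIV. (\<lambda>i. A h * munit h i)) i = (\<Sum>h\<in>UNIV. if i = h then A h else 0)"
      by (simp add: sum_apply munit_def if_distrib cong: if_cong)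
    then show "(\<Sum>h\<in>UNIV. (\<lambda>i. A h * munit h i)) i = A i" by simp
  qed
  show ?thesis
    using lead[of UNIV, OF finite] unfolding exponents mpower_def .
qed

lemma resonant_monomial_support:
  assumes "resonance_generators r lam P" and "s \<in> first r" and "(munit s + mcomb P K) h \<noteq> 0"
  shows "h \<in> first r"
proof (rule ccontr)
  assume "h \<notin> first r"
  with assms(2) have "munit s h = 0" by (auto simp: munit_def)
  moreover have "mcomb P K h = 0"
    using assms(1) \<open>h \<notin> first r\<close> by (simp add: mcomb_def resonance_generators_def)
  ultimately show False using assms(3) by simp
qed

text \<open>
  A resonant monomial of component \<open>s\<close> contains only the first \<open>r\<close> coordinates, and substituting the
  first \<open>r\<close> components of the previous iterate into it multiplies it by a series in the \<open>z\<^bsup>KP\<^esup>\<close>.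
\<close>

lemma inverse_iterate_resonant:
  assumes gens: "resonance_generators r lam P" and shape: "normal_form_shape r lam P N"
    and "s \<in> first r" and "mcoeff (inverse_iterate lam N k s) Q \<noteq> 0"
  shows "\<exists>K. Q = munit s + mcomb P K"
  using assms(3,4)
proof (induction k arbitrary: s Q)
  case 0
  then show ?case by (simp add: zero_mfps_def)
next
  case (Suc k)
  define M where "M = inverse_iterate lam N k"
  show ?case
  proof (cases "Q = munit s")
    case True
    then have "Q = munit s + mcomb P 0" by simp
    then show ?thesis by blast
  next
    case False
    with Suc.prems(2) have "(\<Sum>A | 2 \<le> mdeg A \<and> mdeg A \<le> mdeg Q.
        mcoeff (N s) A * mcoeff (\<Prod>h\<in>UNIV. M h ^ A h) Q) \<noteq> 0"
      by (auto simp: inverse_step_def M_def)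
    then obtain A where A: "2 \<le> mdeg A" "mcoeff (N s) A \<noteq> 0"
        "mcoeff (\<Prod>h\<in>UNIV. M h ^ A h) Q \<noteq> 0"
      by (auto elim!: sum.not_neutral_contains_not_neutral)
    with shape Suc.prems(1) obtain K where K: "A = munit s + mcomb P K"
      unfolding normal_form_shape_def by metis
    have "has_leading_term P A (mpower (\<chi> h. mcoeff (M h) (munit h)) A) (\<Prod>h\<in>UNIV. M h ^ A h)"
    proof (rule has_leading_term_monomial)
      fix h assume "A h \<noteq> 0"
      then have "h \<in> first r"
        using resonant_monomial_support[OF gens Suc.prems(1)] K by simp
      then show "has_leading_term P (munit h) ((\<chi> h. mcoeff (M h) (munit h)) $ h) (M h)"
        unfolding has_leading_term_def M_def using Suc.IH by (intro conjI) (blast, simp)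
    qed
    with A(3) obtain K' where "Q = A + mcomb P K'"
      unfolding has_leading_term_def by metis
    with K have "Q = munit s + mcomb P (K + K')" by (simp add: mcomb_add add.assoc)
    then show ?thesis by blast
  qed
qed

lemma formal_inverse_leading_term:
  assumes "resonance_generators r lam P" and "normal_form_shape r lam P N" and "s \<in> first r"
  shows "has_leading_term P (munit s) (inverse (lam $ s)) (formal_inverse lam N s)"
  unfolding has_leading_term_def
proof
  show "\<forall>Q. mcoeff (formal_inverse lam N s) Q \<noteq> 0 \<longrightarrow> (\<exists>K. Q = munit s + mcomb P K)"
    using inverse_iterate_resonant[OF assms] by (simp add: formal_inverse_def)
  show "mcoeff (formal_inverse lam N s) (munit s) = inverse (lam $ s)"
    using has_diagonal_part_formal_inverse[of lam N]
    by (simp add: has_diagonal_part_def inverse_eigenvalues_def)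
qed

lemma normal_form_shape_inverse:
  assumes "resonance_generators r lam P" and "normal_form_shape r lam P N"
  shows "normal_form_shape r (inverse_eigenvalues lam) P (formal_inverse lam N)"
  unfolding normal_form_shape_def
proof (intro conjI ballI allI impI)
  fix s Q assume "s \<in> first r" "2 \<le> mdeg Q" "mcoeff (formal_inverse lam N s) Q \<noteq> 0"
  with formal_inverse_leading_term[OF assms] obtain K where "Q = munit s + mcomb P K"
    unfolding has_leading_term_def by blast
  with \<open>2 \<le> mdeg Q\<close> show "\<exists>K. K \<noteq> 0 \<and> Q = munit s + mcomb P K"
    by (intro exI[of _ K]) auto
qed (rule has_diagonal_part_formal_inverse)

lemma mpower_inverse_eigenvalues: "mpower (inverse_eigenvalues lam) Q = inverse (mpower lam Q)"
  by (simp add: mpower_def inverse_eigenvalues_def prod_inversef[symmetric] power_inverse o_def)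

lemma nf_order_le:
  "K \<noteq> 0 \<Longrightarrow> s \<in> first r \<Longrightarrow> res_coeff P N K s \<noteq> 0 \<Longrightarrow> nf_order r P N \<le> enat (mdeg K)"
  unfolding nf_order_def
  by (rule Inf_lower) (use mdeg_eq_0_iff[of K] in auto)

text \<open>
  Compare the coefficients of \<open>N \<circ> M = id\<close> at the resonant multi-index \<open>Q = e\<^sub>s + KP\<close>. A nonlinear term
  \<open>z\<^sup>A\<close> of \<open>N\<^sub>s\<close>, \<open>A = e\<^sub>s + K'P\<close>, contributes only if \<open>K = K' + K''\<close>; as \<open>|K|\<close> does not exceed the
  weighted order and \<open>|K'|\<close> is not below it, only \<open>A = Q\<close> is left. It contributes its coefficient times
  the leading coefficient \<open>\<lambda>\<^bsup>-Q\<^esup>\<close> of \<open>M\<^sup>Q\<close>, and this is \<open>\<lambda>\<^sub>s\<inverse>\<close> by resonance. The linear term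
  contributes \<open>\<lambda>\<^sub>s\<close> times the coefficient of \<open>M\<^sub>s\<close>.
\<close>

lemma res_coeff_inverse:
  assumes gens: "resonance_generators r lam P" and shape: "normal_form_shape r lam P N"
    and s: "s \<in> first r" and "K \<noteq> 0" and order: "enat (mdeg K) \<le> nf_order r P N"
  shows "res_coeff P (formal_inverse lam N) K s = - (res_coeff P N K s * (inverse (lam $ s))\<^sup>2)"
proof -
  define M where "M = formal_inverse lam N"
  define Q where "Q = munit s + mcomb P K"
  define tm where "tm A = mcoeff (N s) A * mcoeff (\<Prod>h\<in>UNIV. M h ^ A h) Q" for A
  have "resonance lam s Q"
    using gens s \<open>K \<noteq> 0\<close> unfolding resonance_generators_def Q_def by blast
  then have Q: "mdeg Q \<ge> 2" "mpower lam Q = lam $ s" by (auto simp: resonance_def)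
  have leading: "has_leading_term P (munit s + mcomb P K')
      (mpower (inverse_eigenvalues lam) (munit s + mcomb P K'))
      (\<Prod>h\<in>UNIV. M h ^ (munit s + mcomb P K') h)" for K'
  proof (rule has_leading_term_monomial)
    fix h assume "(munit s + mcomb P K') h \<noteq> 0"
    then have "h \<in> first r" by (rule resonant_monomial_support[OF gens s])
    then show "has_leading_term P (munit h) (inverse_eigenvalues lam $ h) (M h)"
      using formal_inverse_leading_term[OF gens shape] by (simp add: M_def inverse_eigenvalues_def)
  qed
  have tm_0: "tm A = 0" if "mdeg A \<ge> 2" "A \<noteq> Q" for A
  proof (rule ccontr)
    assume "tm A \<noteq> 0"
    then have nz: "mcoeff (N s) A \<noteq> 0" "mcoeff (\<Prod>h\<in>UNIV. M h ^ A h) Q \<noteq> 0"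
      by (auto simp: tm_def)
    with shape s that(1) obtain K' where K': "K' \<noteq> 0" "A = munit s + mcomb P K'"
      unfolding normal_form_shape_def by metis
    have "nf_order r P N \<le> enat (mdeg K')"
      using nz(1) K' s by (intro nf_order_le) (auto simp: res_coeff_def)
    with order have le: "mdeg K \<le> mdeg K'" by (metis enat_ord_simps(1) order_trans)
    from leading[of K'] nz(2) obtain K'' where K'': "Q = A + mcomb P K''"
      unfolding K'(2) has_leading_term_def by blast
    then have "mcomb P K = mcomb P (K' + K'')"
      by (simp add: Q_def K'(2) mcomb_add add.assoc)
    then have "K = K' + K''" by (rule mcomb_cancel[OF gens])
    with le have "K'' = 0" by (simp add: mdeg_add mdeg_eq_0_iff)
    with K'' that(2) show False by simp
  qed
  have "(\<Sum>A | 2 \<le> mdeg A \<and> mdeg A \<le> mdeg Q. tm A) = (\<Sum>A\<in>{Q}. tm A)"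
    using Q tm_0
    by (intro sum.mono_neutral_right)
      (auto intro: finite_subset[OF _ finite_mdeg_le[of "mdeg Q"]])
  also have "\<dots> = mcoeff (N s) Q * inverse (lam $ s)"
    using leading[of K] Q(2)
    by (simp add: tm_def has_leading_term_def Q_def[symmetric] mpower_inverse_eigenvalues)
  finally have "mcoeff (M s) Q = inverse (lam $ s) * (0 - mcoeff (N s) Q * inverse (lam $ s))"
    using Q(1) unfolding M_def tm_def by (subst mcoeff_formal_inverse) auto
  then show ?thesis
    by (simp add: res_coeff_def M_def Q_def power2_eq_square)
qed

section \<open>Inverting a normal form\<close>

lemma inverse_eigenvalues_inverse [simp]: "inverse_eigenvalues (inverse_eigenvalues lam) = lam"
  by (simp add: inverse_eigenvalues_def vec_eq_iff)

lemma resonance_inverse_eigenvalues [simp]: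
  "resonance (inverse_eigenvalues lam) j L \<longleftrightarrow> resonance lam j L"
  by (simp add: resonance_def mpower_inverse_eigenvalues) (simp add: inverse_eigenvalues_def)

lemma resonance_generators_inverse_eigenvalues [simp]:
  "resonance_generators r (inverse_eigenvalues lam) P \<longleftrightarrow> resonance_generators r lam P"
  by (simp add: resonance_generators_def)

text \<open>
  From \<open>T \<circ> \<Phi> = \<Phi> \<circ> N\<close>, \<open>S \<circ> T = id\<close> and \<open>N \<circ> M = id\<close> it follows that
  \<open>S \<circ> \<Phi> = S \<circ> \<Phi> \<circ> N \<circ> M = S \<circ> T \<circ> \<Phi> \<circ> M = \<Phi> \<circ> M\<close>: the same change of coordinates serves the
  inverse germ.
\<close>

lemma poincare_dulac_nf_inverse:
  assumes germs: "biholomorphic_germ_inverse F G" and lam: "\<And>j. lam $ j \<noteq> 0"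
    and nf: "poincare_dulac_nf r lam F P N"
  shows "poincare_dulac_nf r (inverse_eigenvalues lam) G P (formal_inverse lam N)"
proof -
  define M where "M = formal_inverse lam N"
  from nf have gens: "resonance_generators r lam P" and shape: "normal_form_shape r lam P N"
    by (simp_all add: poincare_dulac_nf_def)
  from nf obtain T \<Phi> where T: "has_taylor_series F T" and tangent: "tangent_to_identity \<Phi>"
    and conj: "formal_compose T \<Phi> = formal_compose \<Phi> N"
    by (auto simp: poincare_dulac_nf_def)
  from germs obtain S where S: "has_taylor_series G S"
    by (auto simp: biholomorphic_germ_inverse_def holomorphic_germ_def)
  from germs have germ_facts: "F 0 = 0" "\<forall>\<^sub>F z in nhds 0. G (F z) = z"
    by (simp_all add: biholomorphic_germ_inverse_def)
  have fixed: "fixes_origin T" "fixes_origin \<Phi>" "fixes_origin N" "fixes_origin M"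
    using taylor_series_fixes_origin[OF T \<open>F 0 = 0\<close>] tangent shape
      has_diagonal_part_formal_inverse[of lam N]
    by (auto simp: tangent_to_identity_def normal_form_shape_def M_def
        intro: fixes_origin_if_diagonal_part)
  have NM: "formal_compose N M = formal_id"
    unfolding M_def using shape lam
    by (intro formal_compose_inverse) (auto simp: normal_form_shape_def)
  have "\<Phi> = formal_compose \<Phi> (formal_compose N M)"
    by (simp add: NM formal_compose_id_right)
  also have "\<dots> = formal_compose (formal_compose T \<Phi>) M"
    by (simp add: conj formal_compose_assoc fixed)
  also have "\<dots> = formal_compose T (formal_compose \<Phi> M)"
    by (simp add: formal_compose_assoc fixed)
  finally have "formal_compose S \<Phi> = formal_compose S (formal_compose T (formal_compose \<Phi> M))"
    by simp
  also have "\<dots> = formal_compose (formal_compose S T) (formal_compose \<Phi> M)"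
    by (simp add: formal_compose_assoc fixed fixes_origin_compose)
  also have "formal_compose S T = formal_id"
    by (rule taylor_series_of_inverse[OF S T germ_facts])
  also have "formal_compose formal_id (formal_compose \<Phi> M) = formal_compose \<Phi> M"
    by (simp add: formal_compose_id_left fixed fixes_origin_compose)
  finally have "formal_compose S \<Phi> = formal_compose \<Phi> M" .
  with S tangent gens normal_form_shape_inverse[OF gens shape] show ?thesis
    unfolding poincare_dulac_nf_def M_def by auto
qed

lemma nf_order_ge_1: "1 \<le> nf_order r P N"
  unfolding nf_order_def by (rule Inf_greatest) (auto simp: one_enat_def)

lemma nf_order_attained:
  assumes "nf_order r P N \<noteq> \<infinity>"
  obtains K s where "K \<noteq> 0" "s \<in> first r" "res_coeff P N K s \<noteq> 0" "nf_order r P N = enat (mdeg K)"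
proof -
  define A where "A = {enat (mdeg K) | K s. mdeg K \<ge> 1 \<and> s \<in> first r \<and> res_coeff P N K s \<noteq> 0}"
  have "A \<noteq> {}" using assms unfolding nf_order_def A_def[symmetric] by (auto simp: Inf_enat_def)
  then have "Inf A \<in> A" by (auto simp: Inf_enat_def intro: LeastI)
  then obtain K s where "mdeg K \<ge> 1" "s \<in> first r" "res_coeff P N K s \<noteq> 0"
      "nf_order r P N = enat (mdeg K)"
    unfolding nf_order_def A_def[symmetric] by (auto simp: A_def)
  with that[of K s] show thesis by fastforce
qed

lemma nf_order_inverse:
  assumes gens: "resonance_generators r lam P" and shape: "normal_form_shape r lam P N"
    and lam: "\<And>j. lam $ j \<noteq> 0"
  shows "nf_order r P (formal_inverse lam N) = nf_order r P N"
proof -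
  define M where "M = formal_inverse lam N"
  have coeff: "res_coeff P M K s = 0 \<longleftrightarrow> res_coeff P N K s = 0"
    if "K \<noteq> 0" "s \<in> first r" "enat (mdeg K) \<le> nf_order r P N" for K s
    using res_coeff_inverse[OF gens shape] that lam by (simp add: M_def)
  have "nf_order r P N \<le> nf_order r P M"
  proof (cases "nf_order r P M = \<infinity>")
    case False
    then obtain K s where K: "K \<noteq> 0" "s \<in> first r" "res_coeff P M K s \<noteq> 0"
        "nf_order r P M = enat (mdeg K)"
      by (rule nf_order_attained)
    show ?thesis
    proof (rule ccontr)
      assume less: "\<not> nf_order r P N \<le> nf_order r P M"
      with K have "res_coeff P N K s \<noteq> 0" using coeff[of K s] by simp
      with K less show False using nf_order_le[of K s r P N] by simp
    qed
  qed simp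
  moreover have "nf_order r P M \<le> nf_order r P N"
  proof (cases "nf_order r P N = \<infinity>")
    case False
    then obtain K s where K: "K \<noteq> 0" "s \<in> first r" "res_coeff P N K s \<noteq> 0"
        "nf_order r P N = enat (mdeg K)"
      by (rule nf_order_attained)
    then have "res_coeff P M K s \<noteq> 0" using coeff[of K s] by simp
    with K show ?thesis using nf_order_le[of K s r P M] by simp
  qed simp
  ultimately show ?thesis by (simp add: M_def)
qed

section \<open>The differential of the inverse germ\<close>

lemma biholomorphic_germ_inverse_sym:
  "biholomorphic_germ_inverse F G \<Longrightarrow> biholomorphic_germ_inverse G F"
  by (auto simp: biholomorphic_germ_inverse_def)

lemma holomorphic_germ_components:
  assumes "holomorphic_germ F" and "F 0 = 0"
  shows "(\<lambda>z. F z $ j) \<in> vanishing_order 1"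
proof -
  from assms obtain T where T: "has_taylor_series F T" by (auto simp: holomorphic_germ_def)
  have "has_jet 0 (\<lambda>z. F z $ j) (T j)" using T by (rule has_taylor_series_imp_has_jet)
  then show ?thesis
    by (rule has_jet_vanishing_order)
      (use taylor_series_fixes_origin[OF T assms(2)] in \<open>auto simp: fixes_origin_def mdeg_eq_0_iff\<close>)
qed

text \<open>
  As \<open>G(z) = O(\<parallel>z\<parallel>)\<close>, there is an estimate \<open>\<parallel>z\<parallel> = \<parallel>G(F(z))\<parallel> \<le> C \<parallel>F(z)\<parallel>\<close> near the origin. If \<open>\<lambda>\<^sub>j\<close> were 0,
  then \<open>F(z) = o(\<parallel>z\<parallel>)\<close> on the \<open>j\<close>-th axis.
\<close>

lemma eigenvalue_nonzero:
  fixes F G :: "'n::finite cvec \<Rightarrow> 'n cvec"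
  assumes germs: "biholomorphic_germ_inverse F G" and diff: "has_diagonal_differential lam F"
  shows "lam $ j \<noteq> 0"
proof
  assume lam: "lam $ j = 0"
  from germs have G: "holomorphic_germ G" "G 0 = 0" and F: "holomorphic_germ F" "F 0 = 0"
    and GF: "\<forall>\<^sub>F z in nhds 0. G (F z) = z"
    by (simp_all add: biholomorphic_germ_inverse_def)
  from bigo_norm_if_components[OF holomorphic_germ_components[OF G]]
  obtain C where C: "C > 0" "\<forall>\<^sub>F z in nhds 0. norm (G z) \<le> C * norm z"
    unfolding vanishing_order_def by (auto elim: landau_o.bigE)
  have "filterlim F (nhds 0) (nhds 0)"
    by (intro filterlim_if_vanishing_order_1 bigo_norm_if_components holomorphic_germ_components F)
  with C(2) have "\<forall>\<^sub>F z in nhds 0. norm (G (F z)) \<le> C * norm (F z)"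
    by (rule eventually_compose_filterlim)
  with GF have "\<forall>\<^sub>F z in nhds 0. norm z \<le> C * norm (F z)"
    by eventually_elim simp
  then obtain d1 where d1: "d1 > 0" "\<And>z. norm z < d1 \<Longrightarrow> norm z \<le> C * norm (F z)"
    by (auto simp: eventually_nhds_metric)
  have "\<forall>e>0. \<exists>d>0. \<forall>z. norm (z - 0) < d \<longrightarrow>
      norm (F z - F 0 - (\<chi> j. lam $ j * (z - 0) $ j)) \<le> e * norm (z - 0)"
    using diff unfolding has_diagonal_differential_def has_derivative_at_alt by blast
  \<comment> \<open>with this \<open>e\<close> the two estimates combine to \<open>\<parallel>z\<parallel> \<le> \<parallel>z\<parallel> / 2\<close> on the axis\<close>
  from this[rule_format, of "1 / (2 * C)"] C(1) F(2)
  obtain d2 where d2: "d2 > 0"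
    "\<And>z. norm z < d2 \<Longrightarrow> norm (F z - (\<chi> j. lam $ j * z $ j)) \<le> 1 / (2 * C) * norm z"
    by auto
  define \<rho> where "\<rho> = min d1 d2 / 2"
  have \<rho>: "\<rho> > 0" "\<rho> < d1" "\<rho> < d2"
    using d1(1) d2(1) by (auto simp: \<rho>_def min_def)
  define z :: "'n cvec" where "z = \<rho> *\<^sub>R axis j 1"
  have z: "norm z > 0" "norm z < d1" "norm z < d2"
    using \<rho> by (simp_all add: z_def)
  have "(\<chi> i. lam $ i * z $ i) = 0"
    using lam by (auto simp: vec_eq_iff z_def axis_def)
  then have "norm (F z) \<le> 1 / (2 * C) * norm z"
    using d2(2)[OF z(3)] by simp
  then have "C * norm (F z) \<le> norm z / 2"
    using C(1) by (simp add: field_simps)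
  moreover have "norm z \<le> C * norm (F z)"
    using z(2) by (rule d1(2))
  ultimately show False using z(1) by simp
qed

lemma has_diagonal_differential_inverse:
  fixes F G :: "'n::finite cvec \<Rightarrow> 'n cvec"
  assumes germs: "biholomorphic_germ_inverse F G" and diff: "has_diagonal_differential lam F"
  shows "has_diagonal_differential (inverse_eigenvalues lam) G"
proof -
  from germs have G: "holomorphic_germ G" "G 0 = 0" and FG: "\<forall>\<^sub>F z in nhds 0. F (G z) = z"
    by (simp_all add: biholomorphic_germ_inverse_def)
  have "filterlim G (nhds 0) (nhds 0)"
    by (intro filterlim_if_vanishing_order_1 bigo_norm_if_components holomorphic_germ_components G)
  then have cont: "continuous (at 0) G"
    by (simp add: continuous_at G(2) tendsto_mono[OF at_within_le_nhds])
  from FG obtain U where U: "open U" "0 \<in> U" "\<And>z. z \<in> U \<Longrightarrow> F (G z) = z"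
    by (auto simp: eventually_nhds)
  have lin: "bounded_linear (\<lambda>z :: 'n cvec. \<chi> j. inverse_eigenvalues lam $ j * z $ j)"
    by (rule linear_conv_bounded_linear[THEN iffD1], rule linearI)
      (auto simp: vec_eq_iff distrib_left)
  have "(G has_derivative (\<lambda>z. \<chi> j. inverse_eigenvalues lam $ j * z $ j)) (at 0)"
  proof (rule has_derivative_inverse_basic[OF _ lin _ cont U])
    show "(F has_derivative (\<lambda>z. \<chi> j. lam $ j * z $ j)) (at (G 0))"
      using diff by (simp add: has_diagonal_differential_def G(2))
    show "(\<lambda>z. \<chi> j. inverse_eigenvalues lam $ j * z $ j) \<circ> (\<lambda>z. \<chi> j. lam $ j * z $ j) = id"
      using eigenvalue_nonzero[OF germs diff]
      by (auto simp: fun_eq_iff vec_eq_iff inverse_eigenvalues_def field_simps)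
  qed
  then show ?thesis by (simp add: has_diagonal_differential_def)
qed

section \<open>The parabolic shadow of the inverse\<close>

lemma shadow_coeff_inverse:
  assumes "resonance_generators r lam P" and "normal_form_shape r lam P N"
    and "\<And>j. lam $ j \<noteq> 0" and "nf_order r P N = enat k" and "mdeg K = k" and "s \<in> first r"
  shows "res_coeff P (formal_inverse lam N) K s / inverse_eigenvalues lam $ s =
    - (res_coeff P N K s / lam $ s)"
proof -
  have "enat 1 \<le> enat k" using nf_order_ge_1[of r P N] assms(4) by (simp add: one_enat_def)
  with assms(5) have "K \<noteq> 0" by auto
  from res_coeff_inverse[OF assms(1,2,6) this] assms(3-5) show ?thesis
    by (simp add: inverse_eigenvalues_def power2_eq_square field_simps)
qed

lemma shadow_part_inverse:
  assumes "resonance_generators r lam P" and "normal_form_shape r lam P N"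
    and "\<And>j. lam $ j \<noteq> 0" and "nf_order r P N = enat k"
  shows "shadow_part r (inverse_eigenvalues lam) P (formal_inverse lam N) k u =
    - shadow_part r lam P N k u"
proof -
  have neg: "(\<Sum>h\<in>first r. of_nat (P t h) *
        (res_coeff P (formal_inverse lam N) K h / inverse_eigenvalues lam $ h)) =
      - (\<Sum>h\<in>first r. of_nat (P t h) * (res_coeff P N K h / lam $ h))"
    if "mdeg K = k" for K t
    unfolding sum_negf[symmetric]
    by (intro sum.cong refl) (simp only: shadow_coeff_inverse[OF assms that] mult_minus_right)
  have "(\<Sum>K | mdeg K = k. (\<Sum>h\<in>first r. of_nat (P t h) *
        (res_coeff P (formal_inverse lam N) K h / inverse_eigenvalues lam $ h)) * mpower u K) =
      - (\<Sum>K | mdeg K = k.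
        (\<Sum>h\<in>first r. of_nat (P t h) * (res_coeff P N K h / lam $ h)) * mpower u K)" for t
    by (subst sum_negf[symmetric], intro sum.cong refl) (simp only: neg mem_Collect_eq mult_minus_left)
  then show ?thesis by (simp add: shadow_part_def vec_eq_iff)
qed

lemma shadow_part_scale:
  fixes u :: "'m::finite cvec"
  shows "shadow_part r lam P N k (c *s u) = c ^ Suc k *s shadow_part r lam P N k u"
proof -
  have "(\<Sum>K | mdeg K = k. X K * mpower (c *s u) K) = c ^ k * (\<Sum>K | mdeg K = k. X K * mpower u K)"
    for X :: "('m \<Rightarrow> nat) \<Rightarrow> complex"
    unfolding sum_distrib_left by (intro sum.cong refl) (simp add: mpower_scale)
  then show ?thesis by (simp add: shadow_part_def vec_eq_iff)
qed

lemma affine_chart_scale: "c \<noteq> 0 \<Longrightarrow> affine_chart i (c *s x) = affine_chart i x"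
  by (simp add: affine_chart_def vec_eq_iff)

lemma affine_chart_minus: "affine_chart i (- x) = affine_chart i x"
  using affine_chart_scale[of "- 1" i x] by (simp add: vector_sneg_minus1[symmetric])

text \<open>
  The shadow \<open>u + H(u)\<close> of \<open>F\<close> becomes \<open>u - H(u)\<close>. Since \<open>H\<close> and \<open>-H\<close> induce the same map of the projective
  space, the directors do not change, but the normalization of \<open>v\<close> does. The factor \<open>\<zeta>\<close>
  restores it: \<open>-H(\<zeta>v) = -\<zeta>\<^bsup>k+1\<^esup> H(v) = \<zeta> H(v)\<close>.
\<close>

lemma attracting_nondegenerate_at_inverse:
  assumes germs: "biholomorphic_germ_inverse F G" and lam: "\<And>j. lam $ j \<noteq> 0"
    and attr: "attracting_nondegenerate_at r lam F P N k f v" and \<zeta>: "\<zeta> ^ k = - 1"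
  shows "attracting_nondegenerate_at r (inverse_eigenvalues lam) G P (formal_inverse lam N) k
    (parabolic_shadow r (inverse_eigenvalues lam) P (formal_inverse lam N) k) (\<zeta> *s v)"
proof -
  define M where "M = formal_inverse lam N"
  define g where "g = parabolic_shadow r (inverse_eigenvalues lam) P M k"
  define H where "H = shadow_part r lam P N k"
  from attr have nf: "poincare_dulac_nf r lam F P N" and order: "nf_order r P N = enat k"
    and f: "f = parabolic_shadow r lam P N k" and v: "v \<noteq> 0"
    and attractive: "fully_attractive k f v" and norm: "normalized_representative k f v"
    by (auto simp: attracting_nondegenerate_at_def nondegenerate_char_direction_def)
  from nf have gens: "resonance_generators r lam P" and shape: "normal_form_shape r lam P N"
    by (simp_all add: poincare_dulac_nf_def)
  have k: "k \<noteq> 0" using nf_order_ge_1[of r P N] order by (auto simp: one_enat_def)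
  then have \<zeta>0: "\<zeta> \<noteq> 0" using \<zeta> by (auto simp: power_0_left)
  have fH: "f x - x = H x" for x by (simp add: f H_def parabolic_shadow_def)
  have gH: "g x - x = - H x" for x
    by (simp add: g_def parabolic_shadow_def M_def H_def shadow_part_inverse[OF gens shape lam order])
  have "g (\<zeta> *s v) - \<zeta> *s v = - (\<zeta> ^ Suc k *s H v)"
    by (simp add: gH) (simp add: H_def shadow_part_scale)
  also have "\<dots> = \<zeta> *s H v" by (simp add: \<zeta> vec_eq_iff)
  also have "H v = (- inverse (of_nat k)) *s v"
    using norm by (simp add: normalized_representative_def fH)
  finally have eigen: "g (\<zeta> *s v) - \<zeta> *s v = (- inverse (of_nat k)) *s (\<zeta> *s v)"
    by (simp add: vec_eq_iff)
  have "is_director k f v \<delta>" if "is_director k g (\<zeta> *s v) \<delta>" for \<delta>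
    using that \<zeta>0 unfolding is_director_def fH gH
    by (auto simp: affine_chart_minus affine_chart_scale)
  with attractive have "fully_attractive k g (\<zeta> *s v)"
    by (auto simp: fully_attractive_def)
  moreover have "nondegenerate_char_direction g (\<zeta> *s v)"
    unfolding nondegenerate_char_direction_def
  proof
    show "\<zeta> *s v \<noteq> 0" using v \<zeta>0 by (auto simp: vec_eq_iff)
    show "\<exists>\<tau>. \<tau> \<noteq> 0 \<and> g (\<zeta> *s v) - \<zeta> *s v = \<tau> *s (\<zeta> *s v)"
      using eigen k by (intro exI[of _ "- inverse (of_nat k)"]) simp
  qed
  ultimately show ?thesis
    using poincare_dulac_nf_inverse[OF germs lam nf] nf_order_inverse[OF gens shape lam] order eigen
    by (simp add: attracting_nondegenerate_at_def normalized_representative_def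
        flip: M_def g_def)
qed

text \<open>
  The sums in the condition are homogeneous of degree \<open>k\<close> in \<open>v\<close>, so that \<open>\<zeta>\<^sup>k = -1\<close> makes up for the
  changed sign of their coefficients.
\<close>

lemma parabolically_attracting_at_inverse:
  assumes germs: "biholomorphic_germ_inverse F G" and lam: "\<And>j. lam $ j \<noteq> 0"
    and attr: "parabolically_attracting_at r lam F P N k f v" and \<zeta>: "\<zeta> ^ k = - 1"
  shows "parabolically_attracting_at r (inverse_eigenvalues lam) G P (formal_inverse lam N) k
    (parabolic_shadow r (inverse_eigenvalues lam) P (formal_inverse lam N) k) (\<zeta> *s v)"
proof -
  from attr have nondeg: "attracting_nondegenerate_at r lam F P N k f v"
    and neg: "\<And>j. j \<in> first r \<Longrightarrow>
      Re (\<Sum>K | mdeg K = k. res_coeff P N K j / lam $ j * mpower v K) < 0"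
    by (auto simp: parabolically_attracting_at_def)
  then have gens: "resonance_generators r lam P" and shape: "normal_form_shape r lam P N"
    and order: "nf_order r P N = enat k"
    by (simp_all add: attracting_nondegenerate_at_def poincare_dulac_nf_def)
  have "(\<Sum>K | mdeg K = k. res_coeff P (formal_inverse lam N) K j / inverse_eigenvalues lam $ j *
      mpower (\<zeta> *s v) K) = (\<Sum>K | mdeg K = k. res_coeff P N K j / lam $ j * mpower v K)"
    if "j \<in> first r" for j
    using that \<zeta> by (intro sum.cong refl)
      (simp add: shadow_coeff_inverse[OF gens shape lam order] mpower_scale)
  with neg attracting_nondegenerate_at_inverse[OF germs lam nondeg \<zeta>] show ?thesis
    by (simp add: parabolically_attracting_at_def)
qed

lemma root_of_minus_one:
  assumes "k \<noteq> 0"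
  obtains \<zeta> :: complex where "\<zeta> ^ k = - 1"
proof
  show "cis (pi / of_nat k) ^ k = - 1"
    using assms by (simp add: Complex.DeMoivre)
qed

theorem proposition5p1:
  fixes F G :: "'n::{finite,linorder} cvec \<Rightarrow> 'n cvec"
    and lam :: "'n cvec"
    and r :: nat
    and k0 :: enat
  assumes "biholomorphic_germ_inverse F G"
    and "has_diagonal_differential lam F"
    and "1 \<le> r" and "r \<le> CARD('n)"
    and "m_resonant TYPE('m::finite) r lam F"
    and "has_weighted_order TYPE('m) r lam F k0"
  shows "m_resonant TYPE('m) r (inverse_eigenvalues lam) G \<and>
    has_weighted_order TYPE('m) r (inverse_eigenvalues lam) G k0 \<and>
    (attracting_nondegenerate TYPE('m) r lam F \<longrightarrow>
      attracting_nondegenerate TYPE('m) r (inverse_eigenvalues lam) G) \<and>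
    (parabolically_attracting TYPE('m) r lam F \<longrightarrow>
      parabolically_attracting TYPE('m) r (inverse_eigenvalues lam) G)"
proof -
  note germs = assms(1)
  have lam: "lam $ j \<noteq> 0" for j by (rule eigenvalue_nonzero[OF assms(1,2)])
  then have lam': "inverse_eigenvalues lam $ j \<noteq> 0" for j by (simp add: inverse_eigenvalues_def)
  have resonant: "m_resonant TYPE('m) r (inverse_eigenvalues lam) G"
    using assms(5) has_diagonal_differential_inverse[OF assms(1,2)] by (simp add: m_resonant_def)
  have order: "has_weighted_order TYPE('m) r (inverse_eigenvalues lam) G k0"
    unfolding has_weighted_order_def
  proof (intro conjI allI impI)
    show "\<exists>(P :: 'm \<Rightarrow> 'n \<Rightarrow> nat) N. poincare_dulac_nf r (inverse_eigenvalues lam) G P N"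
      using assms(6) poincare_dulac_nf_inverse[OF germs lam] unfolding has_weighted_order_def
      by blast
  next
    fix P :: "'m \<Rightarrow> 'n \<Rightarrow> nat" and N
    assume nf: "poincare_dulac_nf r (inverse_eigenvalues lam) G P N"
    \<comment> \<open>inverting a normal form of \<open>G\<close> leads back to \<open>F\<close>, whose order is known\<close>
    define M where "M = formal_inverse (inverse_eigenvalues lam) N"
    have "poincare_dulac_nf r lam F P M"
      using poincare_dulac_nf_inverse[OF biholomorphic_germ_inverse_sym[OF germs] lam' nf]
      by (simp add: M_def)
    then have "nf_order r P M = k0"
      using assms(6) by (auto simp: has_weighted_order_def)
    moreover have "nf_order r P M = nf_order r P N"
      unfolding M_def using nf lam'
      by (intro nf_order_inverse) (auto simp: poincare_dulac_nf_def)
    ultimately show "nf_order r P N = k0" by simp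
  qed
  have root: "\<exists>\<zeta> :: complex. \<zeta> ^ k = - 1"
    if "attracting_nondegenerate_at r lam F P N k f v"
    for P :: "'m \<Rightarrow> 'n \<Rightarrow> nat" and N k f v
  proof -
    have "enat 1 \<le> enat k"
      using that nf_order_ge_1[of r P N]
      by (simp add: attracting_nondegenerate_at_def one_enat_def)
    then show ?thesis using root_of_minus_one[of k] by auto
  qed
  have nondegenerate: "attracting_nondegenerate TYPE('m) r (inverse_eigenvalues lam) G"
    if "attracting_nondegenerate TYPE('m) r lam F"
    using that attracting_nondegenerate_at_inverse[OF germs lam] root
    unfolding attracting_nondegenerate_def by meson
  have parabolic: "parabolically_attracting TYPE('m) r (inverse_eigenvalues lam) G"
    if parab: "parabolically_attracting TYPE('m) r lam F"
  proof -
    from parab obtain P :: "'m \<Rightarrow> 'n \<Rightarrow> nat" and N k f v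
      where at: "parabolically_attracting_at r lam F P N k f v"
      unfolding parabolically_attracting_def by blast
    then obtain \<zeta> :: complex where "\<zeta> ^ k = - 1"
      using root unfolding parabolically_attracting_at_def by blast
    from parabolically_attracting_at_inverse[OF germs lam at this] show ?thesis
      unfolding parabolically_attracting_def by blast
  qed
  from resonant order nondegenerate parabolic show ?thesis by blast
qed

end
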